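(* For every $v\in\{3^n,\ 2\cdot 7^n+1,\ 2\cdot 13^n+1 : n\ge 1\}$ there exist a GLS$(2,(3,\{3,6\},\{3\},\{6\}),2v)$ and a GLS*$(1,2;2,(3,\{3,6\},\{3\},\{6\}),2v)$.
   Context: An S$(\lambda;2,K,v)$ is a pair $(X,\mathcal{B})$, $|X|=v$, $\mathcal{B}$ a multiset of subsets (blocks) of $X$ with sizes in $K$, each 2-subset of $X$ in exactly $\lambda$ blocks. An S$(3,K,v)$ is a pair $(X,\mathcal{B})$ with $\mathcal{B}$ a set of subsets of sizes in $K$, each 3-subset in exactly one block. An LS$(1,\lambda;2,(3,K),v)$ is a collection $(X,\mathcal{B}_r)_{r\in R}$ of S$(\lambda;2,K,v)$ on a common $X$ such that $(X,\bigcup_r\mathcal{B}_r)$ (ordinary union) is an S$(3,K,v)$ and each block $B$ of that union occurs exactly $|B|-2$ times in the multiset $\{B: B\in\mathcal{B}_r, r\in R\}$; it is an LS* if moreover each $B\in\mathcal{B}_r$ with $|B|\ge4$ occurs exactly $\lambda$ times in $\mathcal{B}_r$. An S$(\lambda;2,(K_0,K_1,K_2),v)$ is a quadruple $(S,\infty_1,\infty_2,\mathcal{B})$ with $|S|=v-2$, $\infty_1\ne\infty_2$, $\infty_1,\infty_2\notin S$, such that $(S\cup\{\infty_1,\infty_2\},\mathcal{B})$ is an S$(\lambda;2,K_0\cup K_1\cup K_2,v)$ and $|B|\in K_i$ for each block $B$ with $|B\cap\{\infty_1,\infty_2\}|=i$. An LS$(1,\lambda;2,(3,K_0,K_1,K_2),v)$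 is a collection $(S,\infty_1,\infty_2,\mathcal{B}_r)_{r\in R}$ of such designs with $(S\cup\{\infty_1,\infty_2\},\mathcal{B}_r)_{r\in R}$ an LS$(1,\lambda;2,(3,K_0\cup K_1\cup K_2),v)$ (LS* analogously). A good design GS$(\lambda;2,(K_0,\{3\},K_2),v)$ is a 5-tuple $(S,\infty_1,\infty_2,\mathcal{B},D)$ where $(S,\infty_1,\infty_2,\mathcal{B})$ is an S$(\lambda;2,(K_0,\{3\},K_2),v)$ and $D$ is an Eulerian digraph on $S$ (every vertex has equal in-degree and out-degree) whose underlying undirected graph has edge set $\{\{x,y\}: x,y\in S, \{\infty_i,x,y\}\in\mathcal{B}, i\in\{1,2\}\}$. A GLS$(1,\lambda;2,(3,K_0,\{3\},K_2),v)$ is a collection $(S,\infty_1,\infty_2,\mathcal{B}_r,D_r)_{r\in R}$ of such GS where $(S,\infty_1,\infty_2,\mathcal{B}_r)_{r\in R}$ is an LS$(1,\lambda;2,(3,K_0,\{3\},K_2),v)$ and every ordered pair $(x,y)$ of distinct elements of $S$ not contained in any block $B$ with $\{\infty_1,\infty_2\}\subset B$ is an arc of exactly one $D_r$. A GLS* is a GLS whose underlying LS is an LS*. GLS$(2,(3,K_0,\{3\},K_2),v)$ means GLS$(1,1;2,(3,K_0,\{3\},K_2),v)$. *)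

theory Defs
  imports "HOL-Library.Multiset" "Graph_Theory.Pair_Digraph"
begin

text \<open>
  All designs are finite. Block collections are multisets of sets, so repeated blocks are allowed
  unless excluded. Indexed collections are families over a finite index set \<open>R\<close>; distinct indices
  may carry equal designs.
\<close>

definition S2 :: "nat \<Rightarrow> nat set \<Rightarrow> nat \<Rightarrow> 'a set \<Rightarrow> 'a set multiset \<Rightarrow> bool" where
  "S2 l K v X \<B> \<longleftrightarrow>
     finite X \<and> card X = v \<and>
     (\<forall>B. B \<in># \<B> \<longrightarrow> B \<subseteq> X \<and> card B \<in> K) \<and>
     (\<forall>P. P \<subseteq> X \<and> card P = 2 \<longrightarrow> size {#B \<in># \<B>. P \<subseteq> B#} = l)"

definition S3 :: "nat set \<Rightarrow> nat \<Rightarrow> 'a set \<Rightarrow> 'a set set \<Rightarrow> bool" where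
  "S3 K v X \<B> \<longleftrightarrow>
     finite X \<and> card X = v \<and>
     (\<forall>B\<in>\<B>. B \<subseteq> X \<and> card B \<in> K) \<and>
     (\<forall>T. T \<subseteq> X \<and> card T = 3 \<longrightarrow> (\<exists>!B. B \<in> \<B> \<and> T \<subseteq> B))"

text \<open>
  Blocks of size at most 2 cannot occur in an \<open>LS\<close>: the truncated difference \<open>card B - 2\<close> is then 0.
\<close>

definition LS :: "nat \<Rightarrow> nat set \<Rightarrow> nat \<Rightarrow> 'a set \<Rightarrow> 'r set \<Rightarrow> ('r \<Rightarrow> 'a set multiset) \<Rightarrow> bool" where
  "LS l K v X R \<B> \<longleftrightarrow>
     finite R \<and>
     (\<forall>r\<in>R. S2 l K v X (\<B> r)) \<and>
     S3 K v X (\<Union>r\<in>R. set_mset (\<B> r)) \<and>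
     (\<forall>B \<in> (\<Union>r\<in>R. set_mset (\<B> r)). count (\<Sum>r\<in>R. \<B> r) B = card B - 2)"

definition LS_star :: "nat \<Rightarrow> nat set \<Rightarrow> nat \<Rightarrow> 'a set \<Rightarrow> 'r set \<Rightarrow> ('r \<Rightarrow> 'a set multiset) \<Rightarrow> bool" where
  "LS_star l K v X R \<B> \<longleftrightarrow>
     LS l K v X R \<B> \<and>
     (\<forall>r\<in>R. \<forall>B. B \<in># \<B> r \<and> card B \<ge> 4 \<longrightarrow> count (\<B> r) B = l)"

definition S2_012 :: "nat \<Rightarrow> nat set \<Rightarrow> nat set \<Rightarrow> nat set \<Rightarrow> nat \<Rightarrow>
    'a set \<Rightarrow> 'a \<Rightarrow> 'a \<Rightarrow> 'a set multiset \<Rightarrow> bool" where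
  "S2_012 l K\<^sub>0 K\<^sub>1 K\<^sub>2 v S p q \<B> \<longleftrightarrow>
     finite S \<and> card S + 2 = v \<and> p \<noteq> q \<and> p \<notin> S \<and> q \<notin> S \<and>
     S2 l (K\<^sub>0 \<union> K\<^sub>1 \<union> K\<^sub>2) v (S \<union> {p, q}) \<B> \<and>
     (\<forall>B. B \<in># \<B> \<longrightarrow>
        (card (B \<inter> {p, q}) = 0 \<longrightarrow> card B \<in> K\<^sub>0) \<and>
        (card (B \<inter> {p, q}) = 1 \<longrightarrow> card B \<in> K\<^sub>1) \<and>
        (card (B \<inter> {p, q}) = 2 \<longrightarrow> card B \<in> K\<^sub>2))"

definition LS_012 :: "nat \<Rightarrow> nat set \<Rightarrow> nat set \<Rightarrow> nat set \<Rightarrow> nat \<Rightarrow>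
    'a set \<Rightarrow> 'a \<Rightarrow> 'a \<Rightarrow> 'r set \<Rightarrow> ('r \<Rightarrow> 'a set multiset) \<Rightarrow> bool" where
  "LS_012 l K\<^sub>0 K\<^sub>1 K\<^sub>2 v S p q R \<B> \<longleftrightarrow>
     (\<forall>r\<in>R. S2_012 l K\<^sub>0 K\<^sub>1 K\<^sub>2 v S p q (\<B> r)) \<and>
     LS l (K\<^sub>0 \<union> K\<^sub>1 \<union> K\<^sub>2) v (S \<union> {p, q}) R \<B>"

definition LS_012_star :: "nat \<Rightarrow> nat set \<Rightarrow> nat set \<Rightarrow> nat set \<Rightarrow> nat \<Rightarrow>
    'a set \<Rightarrow> 'a \<Rightarrow> 'a \<Rightarrow> 'r set \<Rightarrow> ('r \<Rightarrow> 'a set multiset) \<Rightarrow> bool" where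
  "LS_012_star l K\<^sub>0 K\<^sub>1 K\<^sub>2 v S p q R \<B> \<longleftrightarrow>
     (\<forall>r\<in>R. S2_012 l K\<^sub>0 K\<^sub>1 K\<^sub>2 v S p q (\<B> r)) \<and>
     LS_star l (K\<^sub>0 \<union> K\<^sub>1 \<union> K\<^sub>2) v (S \<union> {p, q}) R \<B>"

text \<open>
  Digraphs are finite, without loops and without parallel arcs; opposite arcs \<open>(x, y)\<close> and
  \<open>(y, x)\<close> may both be present. Eulerian means balanced; connectedness is not required.
\<close>

definition eulerian_digraph :: "'a pair_pre_digraph \<Rightarrow> bool" where
  "eulerian_digraph D \<longleftrightarrow>
     pair_digraph D \<and>
     (\<forall>x\<in>pverts D. in_degree (with_proj D) x = out_degree (with_proj D) x)"

definition underlying_edges :: "'a pair_pre_digraph \<Rightarrow> 'a set set" where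
  "underlying_edges D = {{x, y} | x y. (x, y) \<in> parcs D}"

definition GS :: "nat \<Rightarrow> nat set \<Rightarrow> nat set \<Rightarrow> nat \<Rightarrow>
    'a set \<Rightarrow> 'a \<Rightarrow> 'a \<Rightarrow> 'a set multiset \<Rightarrow> 'a pair_pre_digraph \<Rightarrow> bool" where
  "GS l K\<^sub>0 K\<^sub>2 v S p q \<B> D \<longleftrightarrow>
     S2_012 l K\<^sub>0 {3} K\<^sub>2 v S p q \<B> \<and>
     pverts D = S \<and> eulerian_digraph D \<and>
     underlying_edges D =
       {{x, y} | x y. x \<in> S \<and> y \<in> S \<and> (\<exists>i\<in>{p, q}. {i, x, y} \<in># \<B>)}"

definition GLS :: "nat \<Rightarrow> nat set \<Rightarrow> nat set \<Rightarrow> nat \<Rightarrow> 'a set \<Rightarrow> 'a \<Rightarrow> 'a \<Rightarrow>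
    'r set \<Rightarrow> ('r \<Rightarrow> 'a set multiset) \<Rightarrow> ('r \<Rightarrow> 'a pair_pre_digraph) \<Rightarrow> bool" where
  "GLS l K\<^sub>0 K\<^sub>2 v S p q R \<B> D \<longleftrightarrow>
     (\<forall>r\<in>R. GS l K\<^sub>0 K\<^sub>2 v S p q (\<B> r) (D r)) \<and>
     LS_012 l K\<^sub>0 {3} K\<^sub>2 v S p q R \<B> \<and>
     (\<forall>x\<in>S. \<forall>y\<in>S. x \<noteq> y \<and>
        \<not> (\<exists>r\<in>R. \<exists>B. B \<in># \<B> r \<and> {p, q} \<subseteq> B \<and> {x, y} \<subseteq> B) \<longrightarrow>
        (\<exists>!r. r \<in> R \<and> (x, y) \<in> parcs (D r)))"

definition GLS_star :: "nat \<Rightarrow> nat set \<Rightarrow> nat set \<Rightarrow> nat \<Rightarrow> 'a set \<Rightarrow> 'a \<Rightarrow> 'a \<Rightarrow>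
    'r set \<Rightarrow> ('r \<Rightarrow> 'a set multiset) \<Rightarrow> ('r \<Rightarrow> 'a pair_pre_digraph) \<Rightarrow> bool" where
  "GLS_star l K\<^sub>0 K\<^sub>2 v S p q R \<B> D \<longleftrightarrow>
     GLS l K\<^sub>0 K\<^sub>2 v S p q R \<B> D \<and> LS_012_star l K\<^sub>0 {3} K\<^sub>2 v S p q R \<B>"

end

(*
  Let (X, A) be a Kirkman triple system of order v with parallel classes P d, d in M, |M| = v - 1,
  every class being listed twice, and suppose that the triples outside A are partitioned into
  families T d such that P d Un T d is always a Steiner triple system (a weak form of an LR-design).
  On X x {0, 1}, with the two copies of some point as the points at infinity, a block of P d gives a
  6-block B x {0, 1} and a block of T d is lifted to the transversals of even or of odd level sum;
  this gives a large set with lambda = 1 and 2v - 2 members.  In each member the edges seen from the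
  points at infinity form disjoint 4-cycles K_{2,2}, one for each pair {x, y} completing the
  distinguished point to a block of T d.  The even and the odd lift have the same 4-cycles, and
  orienting them oppositely makes every arc occur once.  Adding the even and the odd member of each
  d gives lambda = 2.

  For v = 3^n take the lines of AG(n, 3), and for T d the triples with sum d, where d is a nonzero
  vector.  For v = 2 q^n + 1 with q = 7, 13 let G = F_q^n act on X = {infinity} Un (G x {0, 1}), and
  develop the following base blocks under G.  Triples whose G-coordinates are pairwise linearly
  independent are used by a sum rule: x + y + z = 0 on one level, x = y + z with y, z on the other
  level.  The pairs which are not covered by them lie in the sets {infinity} Un (L x {0, 1}) with L a
  one-dimensional subspace, and these are filled with copies of a design with 2 q + 1 points that was
  found by computer.  The common block {infinity, (0, 0), (0, 1)} of all these copies is used once.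
*)

theory Submission
  imports Defs "HOL-Computational_Algebra.Primes" "HOL-Library.Code_Binary_Nat"
    "HOL-Library.List_Lexorder" "HOL-Library.Numeral_Type" "HOL-Library.Function_Algebras"
begin

section \<open>Doubling\<close>

text \<open>Multiplicities dictate the shape of the ingredients. A 6-block has to occur 6 - 2 = 4
  times: its triple is in a class for two indices d, and each d has an even and an odd member. A
  lifted triple has to occur once, and its parity selects one of the two members of its d. Two
  copies of the same point can only be covered by a 6-block, which is why each member needs a full
  parallel class.

  The sum rules are such that a triple determines its own translate: moving the origin to g changes
  the signed sum by -3 g or by g, and either can be solved for g when 3 is invertible modulo q. A
  triple inside a translate of {infinity} Un (L x {0, 1}) never obeys such a rule with independent
  coordinates, and every other triple obeys exactly one. On these translates, moving g along L
  rotates the residues of the base design, so the small design must exhaust its triples under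
  rotation. Only the vertical triples {infinity, (c, 0), (c, 1)} are exempt, since they belong to
  every line at once.\<close>

lemma card_Collect_ex1: "\<exists>!x. Q x \<Longrightarrow> card {x. Q x} = 1"
proof (elim ex1E)
  fix x assume "Q x" "\<forall>y. Q y \<longrightarrow> y = x"
  then have "{x. Q x} = {x}" by blast
  then show ?thesis by simp
qed

lemma add_mod2_eq_iff: "(a + t) mod 2 = r mod 2 \<longleftrightarrow> t mod 2 = (r + a) mod 2" for a r t :: nat
  by (auto simp: mod2_eq_if)

text \<open>That the blocks of all \<open>P d\<close> together form a Steiner triple system is not
  assumed. It follows by counting from \<open>card X = card M + 1\<close> and the multiplicities in
  \<open>triple\<close>.\<close>

locale large_set =
  fixes X :: "'a set" and M :: "'m set" and P T :: "'m \<Rightarrow> 'a set set"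
  assumes finite_X: "finite X" and finite_M: "finite M"
    and card_X: "card X = card M + 1"
    and block: "d \<in> M \<Longrightarrow> B \<in> P d \<union> T d \<Longrightarrow> B \<subseteq> X \<and> card B = 3"
    and parallel: "d \<in> M \<Longrightarrow> x \<in> X \<Longrightarrow> \<exists>!B. B \<in> P d \<and> x \<in> B"
    and pair: "d \<in> M \<Longrightarrow> x \<in> X \<Longrightarrow> y \<in> X \<Longrightarrow> x \<noteq> y \<Longrightarrow>
      \<exists>!B. B \<in> P d \<union> T d \<and> x \<in> B \<and> y \<in> B"
    and triple: "B \<subseteq> X \<Longrightarrow> card B = 3 \<Longrightarrow>
      (card {d\<in>M. B \<in> P d} = 2 \<and> (\<forall>d\<in>M. B \<notin> T d)) \<or>
      ((\<forall>d\<in>M. B \<notin> P d) \<and> (\<exists>!d. d \<in> M \<and> B \<in> T d))"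
begin

lemma P_T_disjoint:
  assumes "d \<in> M" "B \<in> P d" "d' \<in> M" shows "B \<notin> T d'"
  using triple[of B] block[of d B] assms by blast

lemma card_P_blocks:
  assumes "d \<in> M" "B \<in> P d" shows "card {d\<in>M. B \<in> P d} = 2"
  using triple[of B] block[of d B] assms by blast

lemma ex1_T:
  assumes "d \<in> M" "B \<in> T d" shows "\<exists>!d. d \<in> M \<and> B \<in> T d"
  using triple[of B] block[of d B] assms by blast

text \<open>
  Double counting of the pairs \<open>(d, B)\<close> with \<open>B\<close> a block of \<open>P d \<union> T d\<close> through \<open>x, y\<close>:
  each \<open>d\<close> contributes one, and each of the \<open>card X - 2\<close> triples through \<open>x, y\<close> contributes
  one or two.
\<close>

lemma P_pair:
  assumes xy: "x \<in> X" "y \<in> X" "x \<noteq> y"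
  shows "\<exists>!B. (\<exists>d\<in>M. B \<in> P d) \<and> x \<in> B \<and> y \<in> B"
proof -
  define Z where "Z = {B. B \<subseteq> X \<and> card B = 3 \<and> x \<in> B \<and> y \<in> B}"
  define A where "A = {B \<in> Z. \<exists>d\<in>M. B \<in> P d}"
  have finZ: "finite Z"
    by (rule finite_subset[of _ "Pow X"]) (auto simp: Z_def finite_X)
  have Z_eq: "Z = (\<lambda>z. {x, y, z}) ` (X - {x, y})"
  proof
    show "Z \<subseteq> (\<lambda>z. {x, y, z}) ` (X - {x, y})"
    proof
      fix B assume B: "B \<in> Z"
      then have "finite B" "card (B - {x, y}) = 1"
        using xy by (auto simp: Z_def card_Diff_subset intro: card_ge_0_finite)
      then obtain z where "B - {x, y} = {z}" by (auto simp: card_1_singleton_iff)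
      then have "B = {x, y, z}" "z \<in> X - {x, y}" using B by (auto simp: Z_def)
      then show "B \<in> (\<lambda>z. {x, y, z}) ` (X - {x, y})" by blast
    qed
  qed (use xy in \<open>auto simp: Z_def card_insert_if\<close>)
  have "inj_on (\<lambda>z. {x, y, z}) (X - {x, y})" by (rule inj_onI) auto
  then have card_Z: "card Z + 1 = card M"
    using xy card_X finite_X card_mono[of X "{x, y}"]
    by (auto simp: Z_eq card_image card_Diff_subset)
  have block_Z: "{B \<in> Z. B \<in> P d \<union> T d} = {B. B \<in> P d \<union> T d \<and> x \<in> B \<and> y \<in> B}" if "d \<in> M" for d
    using block[OF that] by (auto simp: Z_def)
  have "(\<Sum>d\<in>M. card {B \<in> Z. B \<in> P d \<union> T d}) = card M"
  proof -
    have "card {B \<in> Z. B \<in> P d \<union> T d} = 1" if "d \<in> M" for d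
      using pair[OF that xy] unfolding block_Z[OF that] by (auto simp: card_1_singleton_iff)
    then show ?thesis by simp
  qed
  moreover have "(\<Sum>d\<in>M. card {B \<in> Z. B \<in> P d \<union> T d}) = (\<Sum>B\<in>Z. card {d\<in>M. B \<in> P d \<union> T d})"
    by (intro sum_multicount_gen finZ finite_M) simp
  moreover have "(\<Sum>B\<in>Z. card {d\<in>M. B \<in> P d \<union> T d}) = (\<Sum>B\<in>Z. 1 + (if B \<in> A then 1 else 0))"
  proof (rule sum.cong[OF refl])
    fix B assume B: "B \<in> Z"
    then have B3: "B \<subseteq> X" "card B = 3" by (auto simp: Z_def)
    show "card {d\<in>M. B \<in> P d \<union> T d} = 1 + (if B \<in> A then 1 else 0)"
    proof (cases "\<exists>d\<in>M. B \<in> P d")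
      case True
      then obtain d where d: "d \<in> M" "B \<in> P d" by blast
      then have "{d\<in>M. B \<in> P d \<union> T d} = {d\<in>M. B \<in> P d}" using P_T_disjoint by blast
      then show ?thesis using card_P_blocks[OF d] d B by (auto simp: A_def)
    next
      case False
      then have "{d \<in> M. B \<in> P d} = {}" by blast
      then have "card {d \<in> M. B \<in> P d} \<noteq> 2" by (simp only: card.empty)
      then have "\<exists>!d. d \<in> M \<and> B \<in> T d" using triple[OF B3] by blast
      then have "card {d\<in>M. B \<in> P d \<union> T d} = 1"
        using False by (auto simp: card_1_singleton_iff)
      then show ?thesis using False by (auto simp: A_def)
    qed
  qed
  moreover have "\<dots> = card Z + card A"
    by (simp only: sum.distrib)
      (simp add: sum.If_cases finZ A_def Int_def conj_commute)
  ultimately have "card A = 1" using card_Z by linarith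
  then obtain B where B: "A = {B}" by (auto simp: card_1_singleton_iff)
  have "C \<in> A \<longleftrightarrow> (\<exists>d\<in>M. C \<in> P d) \<and> x \<in> C \<and> y \<in> C" for C
    using block by (auto simp: A_def Z_def)
  then show ?thesis unfolding B by (metis singleton_iff)
qed

end

section \<open>Points and blocks of the doubled system\<close>

locale doubling = large_set X M P T
  for X :: "'a set" and M :: "'m set" and P T :: "'m \<Rightarrow> 'a set set" +
  fixes pnt :: "nat \<Rightarrow> 'a" and idx :: "nat \<Rightarrow> 'm"
  assumes pnt: "bij_betw pnt {..<card X} X" and idx: "bij_betw idx {..<card M} M"
begin

text \<open>Points and members are coded by natural numbers: w is the copy of level
  \<open>w mod 2\<close> of the point \<open>pnt (w div 2)\<close>, and r is the member of parity
  \<open>r mod 2\<close> for the index \<open>idx (r div 2)\<close>. The codes 0 and 1 are the two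
  copies of \<open>pnt 0\<close> and serve as the points at infinity.\<close>

definition "W = {..<2 * card X}"
definition D :: "nat \<Rightarrow> 'a" where "D w = pnt (w div 2)"
definition big :: "'a set \<Rightarrow> nat set" where "big B = {w\<in>W. D w \<in> B}"
text \<open>The sum of the codes has the parity of the level sum. For d in M the image of V under
  \<open>D\<close> has three elements, so V is a transversal.\<close>

definition small :: "'m \<Rightarrow> nat \<Rightarrow> nat set set" where
  "small d i = {V. V \<subseteq> W \<and> card V = 3 \<and> D ` V \<in> T d \<and> \<Sum>V mod 2 = i}"
definition blocks :: "nat \<Rightarrow> nat set set" where
  "blocks r = big ` P (idx (r div 2)) \<union> small (idx (r div 2)) (r mod 2)"
definition "R = {..<2 * card M}"

lemma D_in: "w \<in> W \<Longrightarrow> D w \<in> X"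
  using pnt by (auto simp: D_def W_def bij_betw_def)

lemma D_eq: "v \<in> W \<Longrightarrow> w \<in> W \<Longrightarrow> D v = D w \<longleftrightarrow> v div 2 = w div 2"
  using pnt by (auto simp: D_def W_def bij_betw_def inj_on_def less_mult_imp_div_less)

lemma D_parity: "v \<in> W \<Longrightarrow> w \<in> W \<Longrightarrow> D v = D w \<Longrightarrow> v mod 2 = w mod 2 \<Longrightarrow> v = w"
  by (metis D_eq div_mult_mod_eq)

lemma ex_lift:
  assumes "x \<in> X" "i < 2" obtains w where "w \<in> W" "D w = x" "w mod 2 = i"
proof -
  have "x \<in> pnt ` {..<card X}" using assms pnt by (simp add: bij_betw_def)
  then obtain k where k: "k < card X" "pnt k = x" by auto
  show ?thesis using k assms by (intro that[of "2 * k + i"]) (auto simp: W_def D_def)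
qed

lemma idx_in: "r \<in> R \<Longrightarrow> idx (r div 2) \<in> M"
  using idx by (auto simp: R_def bij_betw_def)

lemma finite_W: "finite W" and finite_R: "finite R" and card_W: "card W = 2 * card X"
  by (simp_all add: W_def R_def)

lemma card_R: "card {r\<in>R. Q (idx (r div 2))} = 2 * card {d\<in>M. Q d}"
proof -
  have "bij_betw (\<lambda>r. (idx (r div 2), r mod 2)) {r\<in>R. Q (idx (r div 2))} ({d\<in>M. Q d} \<times> {..<2})"
    unfolding bij_betw_def
  proof
    have inj: "inj_on idx {..<card M}" using idx by (simp add: bij_betw_def)
    show "inj_on (\<lambda>r. (idx (r div 2), r mod 2)) {r\<in>R. Q (idx (r div 2))}"
    proof (rule inj_onI)
      fix r s assume "r \<in> {r\<in>R. Q (idx (r div 2))}" "s \<in> {r\<in>R. Q (idx (r div 2))}"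
        and "(idx (r div 2), r mod 2) = (idx (s div 2), s mod 2)"
      then have "r div 2 = s div 2" "r mod 2 = s mod 2"
        using inj by (auto simp: R_def inj_on_def less_mult_imp_div_less)
      then show "r = s" by (metis div_mult_mod_eq)
    qed
    have "(d, i) \<in> (\<lambda>r. (idx (r div 2), r mod 2)) ` {r\<in>R. Q (idx (r div 2))}"
      if d: "d \<in> M" "Q d" "i < 2" for d and i :: nat
    proof -
      have "d \<in> idx ` {..<card M}" using d idx by (simp add: bij_betw_def)
      then obtain k where "k < card M" "idx k = d" by auto
      then show ?thesis using d by (intro image_eqI[of _ _ "2 * k + i"]) (auto simp: R_def)
    qed
    then show "(\<lambda>r. (idx (r div 2), r mod 2)) ` {r\<in>R. Q (idx (r div 2))} = {d\<in>M. Q d} \<times> {..<2}"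
      by (auto simp: idx_in)
  qed
  then show ?thesis by (simp add: bij_betw_same_card card_cartesian_product)
qed

lemma ex1_R:
  assumes "\<exists>!d. d \<in> M \<and> Q d" "i < 2"
  shows "\<exists>!r. r \<in> R \<and> Q (idx (r div 2)) \<and> r mod 2 = i"
proof -
  obtain d where d: "d \<in> M \<and> Q d" "\<forall>d'. d' \<in> M \<and> Q d' \<longrightarrow> d' = d"
    using assms(1) by (rule ex1E)
  have "d \<in> idx ` {..<card M}" using d(1) idx by (simp add: bij_betw_def)
  then obtain k where k: "k < card M" "idx k = d" by auto
  show ?thesis
  proof (intro ex1I[of _ "2 * k + i"] conjI)
    fix r assume r: "r \<in> R \<and> Q (idx (r div 2)) \<and> r mod 2 = i"
    then have "idx (r div 2) = idx k" using d k idx_in by blast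
    then have "r div 2 = k"
      using r k idx by (auto simp: R_def bij_betw_def inj_on_def less_mult_imp_div_less)
    then show "r = 2 * k + i" using r by (metis mult.commute div_mult_mod_eq)
  qed (use k d(1) assms(2) in \<open>auto simp: R_def\<close>)
qed

lemma D_image_big: "B \<subseteq> X \<Longrightarrow> D ` big B = B"
proof safe
  fix x assume "B \<subseteq> X" "x \<in> B"
  then show "x \<in> D ` big B" using ex_lift[of x 0] by (auto simp: big_def)
qed (auto simp: big_def)

lemma card_big:
  assumes "B \<subseteq> X" shows "card (big B) = 2 * card B"
proof -
  have "bij_betw (\<lambda>w. (D w, w mod 2)) (big B) (B \<times> {..<2})"
    unfolding bij_betw_def
  proof
    show "inj_on (\<lambda>w. (D w, w mod 2)) (big B)"
      by (rule inj_onI) (auto simp: big_def intro: D_parity)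
    have "(x, i) \<in> (\<lambda>w. (D w, w mod 2)) ` big B" if xi: "x \<in> B" "i < 2" for x and i :: nat
    proof -
      obtain w where "w \<in> W" "D w = x" "w mod 2 = i" using ex_lift xi assms by blast
      then show ?thesis using xi by (auto simp: big_def)
    qed
    then show "(\<lambda>w. (D w, w mod 2)) ` big B = B \<times> {..<2}"
      by (auto simp: big_def)
  qed
  then show ?thesis by (simp add: bij_betw_same_card card_cartesian_product)
qed

lemma small_inj: "V \<in> small d i \<Longrightarrow> d \<in> M \<Longrightarrow> inj_on D V"
  using block[of d "D ` V"] by (intro eq_card_imp_inj_on) (auto simp: small_def intro: card_ge_0_finite)

lemma big_block: "r \<in> R \<Longrightarrow> C \<in> P (idx (r div 2)) \<Longrightarrow> C \<subseteq> X \<and> card C = 3 \<and> card (big C) = 6"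
  using block[OF idx_in] card_big by auto

lemma block_cases:
  assumes "r \<in> R" "B \<in> blocks r"
  obtains (big) C where "B = big C" "C \<in> P (idx (r div 2))" "C \<subseteq> X" "card C = 3" "card B = 6"
  | (small) "B \<in> small (idx (r div 2)) (r mod 2)" "card B = 3" "D ` B \<in> T (idx (r div 2))"
      "inj_on D B"
  using assms big_block[of r] small_inj idx_in unfolding blocks_def by (auto simp: small_def)

lemma block_sub: "r \<in> R \<Longrightarrow> B \<in> blocks r \<Longrightarrow> B \<subseteq> W"
  by (auto simp: blocks_def small_def big_def)

lemma finite_blocks: "r \<in> R \<Longrightarrow> finite (blocks r)"
  by (rule finite_subset[of _ "Pow W"]) (auto simp: finite_W dest: block_sub)

lemma mem_big: "w \<in> W \<Longrightarrow> w \<in> big C \<longleftrightarrow> D w \<in> C"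
  by (simp add: big_def)

text \<open>Two copies of one point lie in the 6-block over the class block of that point and in no
  transversal. Copies of two points lie over a unique block C of \<open>P d\<close> or
  \<open>T d\<close>; if C is in \<open>T d\<close>, the level of the third point is forced by the
  parity of r.\<close>

lemma ex1_block_pair:
  assumes r: "r \<in> R" and w: "w \<in> W" "w' \<in> W" "w \<noteq> w'"
  shows "\<exists>!B. B \<in> blocks r \<and> w \<in> B \<and> w' \<in> B"
proof -
  define d where "d = idx (r div 2)"
  have d: "d \<in> M" using r idx_in by (simp add: d_def)
  show ?thesis
  proof (cases "D w = D w'")
    case True
    then have nosmall: False if "V \<in> small d i" "w \<in> V" "w' \<in> V" for V i
      using small_inj[OF that(1) d] that w by (auto dest: inj_onD)
    have "\<exists>!C. C \<in> P d \<and> D w \<in> C" using parallel d w D_in by blast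
    then obtain C where C: "C \<in> P d" "D w \<in> C" "\<And>C'. C' \<in> P d \<Longrightarrow> D w \<in> C' \<Longrightarrow> C' = C"
      by blast
    show ?thesis
    proof (intro ex1I[of _ "big C"] conjI)
      show "big C \<in> blocks r" "w \<in> big C" "w' \<in> big C"
        using True C(1,2) w by (auto simp: blocks_def d_def mem_big)
    next
      fix B assume B: "B \<in> blocks r \<and> w \<in> B \<and> w' \<in> B"
      then obtain C' where "B = big C'" "C' \<in> P d"
        using nosmall by (auto simp: blocks_def d_def)
      then show "B = big C" using C(3)[of C'] B w by (auto simp: mem_big)
    qed
  next
    case False
    obtain C where C: "C \<in> P d \<union> T d" "D w \<in> C" "D w' \<in> C"
      and C_uniq: "\<And>C'. C' \<in> P d \<union> T d \<Longrightarrow> D w \<in> C' \<Longrightarrow> D w' \<in> C' \<Longrightarrow> C' = C"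
      using pair[OF d D_in[OF w(1)] D_in[OF w(2)] False] by blast
    have uniq_small: "D ` V = C" if "V \<in> small d i" "w \<in> V" "w' \<in> V" for V i
      using that by (intro C_uniq) (auto simp: small_def)
    have uniq_big: "C' = C" if "C' \<in> P d" "w \<in> big C'" "w' \<in> big C'" for C'
      using that by (intro C_uniq) (auto simp: big_def)
    show ?thesis
    proof (cases "C \<in> P d")
      case True
      then have "C \<notin> T d" using P_T_disjoint d by blast
      then have nosmall: False if "V \<in> small d i" "w \<in> V" "w' \<in> V" for V i
        using uniq_small[OF that] that by (auto simp: small_def)
      show ?thesis
      proof (intro ex1I[of _ "big C"] conjI)
        show "big C \<in> blocks r" "w \<in> big C" "w' \<in> big C"
          using True C w by (auto simp: blocks_def d_def mem_big)
      next
        fix B assume B: "B \<in> blocks r \<and> w \<in> B \<and> w' \<in> B"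
        then obtain C' where "B = big C'" "C' \<in> P d"
          using nosmall by (auto simp: blocks_def d_def)
        then show "B = big C" using uniq_big B by blast
      qed
    next
      case CP: False
      have nobig: "C' \<notin> P d" if "w \<in> big C'" "w' \<in> big C'" for C'
        using CP uniq_big that by blast
      have CT: "C \<in> T d" using CP C by blast
      then have C3: "C \<subseteq> X" "card C = 3" using block d by blast+
      then have "card (C - {D w, D w'}) = 1"
        using False C by (subst card_Diff_subset) auto
      then obtain z where z: "C - {D w, D w'} = {z}" by (auto simp: card_1_singleton_iff)
      then have Cz: "C = {D w, D w', z}" and zz: "z \<noteq> D w" "z \<noteq> D w'" "z \<in> X"
        using C C3 by auto
      \<comment> \<open>This level solves \<open>u + w + w' = r\<close> modulo 2.\<close>
      obtain u where u: "u \<in> W" "D u = z" "u mod 2 = (r + w + w') mod 2"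
        using ex_lift[OF zz(3), of "(r + w + w') mod 2"] by auto
      have u_ne: "u \<noteq> w" "u \<noteq> w'" using u zz by auto
      have par: "(u + (w + w')) mod 2 = r mod 2" using u(3) by presburger
      have mem: "{w, w', u} \<in> small d (r mod 2)"
        using u w u_ne CT Cz par by (simp add: small_def insert_commute)
      have uniq: "V = {w, w', u}" if V: "V \<in> small d (r mod 2)" "w \<in> V" "w' \<in> V" for V
      proof -
        have "finite V" "card V = 3" using V by (auto simp: small_def intro: card_ge_0_finite)
        then have "card (V - {w, w'}) = 1"
          using w V by (subst card_Diff_subset) auto
        then obtain t where t: "V - {w, w'} = {t}" by (auto simp: card_1_singleton_iff)
        then have Vt: "V = {w, w', t}" "t \<noteq> w" "t \<noteq> w'" using V by auto
        have tW: "t \<in> W" "\<Sum>V mod 2 = r mod 2" using V Vt by (auto simp: small_def)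
        have "D ` V = C" using uniq_small V by blast
        moreover have "D t \<noteq> D w" "D t \<noteq> D w'"
          using inj_onD[OF small_inj[OF V(1) d], of t w] inj_onD[OF small_inj[OF V(1) d], of t w'] Vt
          by auto
        ultimately have "D t = D u" using Vt(1) Cz u(2) by blast
        moreover have "(w + w' + t) mod 2 = r mod 2" using Vt tW w by (simp add: add.assoc)
        then have "t mod 2 = u mod 2" unfolding add_mod2_eq_iff u(3) by (simp add: add.assoc)
        ultimately have "t = u" using D_parity tW u by blast
        then show ?thesis using Vt by simp
      qed
      show ?thesis
      proof (intro ex1I[of _ "{w, w', u}"] conjI)
        show "{w, w', u} \<in> blocks r" using mem by (simp add: blocks_def d_def)
      next
        fix B assume B: "B \<in> blocks r \<and> w \<in> B \<and> w' \<in> B"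
        then have "B \<in> small d (r mod 2)" using nobig by (auto simp: blocks_def d_def)
        then show "B = {w, w', u}" using uniq B by blast
      qed simp_all
    qed
  qed
qed

text \<open>Two distinct points of the image of V determine one class block C. If C contains the
  whole image, V lies in the 6-block over C; otherwise the image is a triple outside all classes,
  and V is itself a block, of the parity of its own sum.\<close>

lemma ex1_block_triple:
  assumes V: "V \<subseteq> W" "card V = 3"
  shows "\<exists>!B. B \<in> (\<Union>r\<in>R. blocks r) \<and> V \<subseteq> B"
proof -
  have finV: "finite V" using finite_W V finite_subset by blast
  have smallV: "V' = V" if "V' \<in> small d i" "V \<subseteq> V'" for V' d i
    using that V by (intro card_subset_eq[symmetric]) (auto simp: small_def intro: card_ge_0_finite)
  have ex_idx: "\<exists>r\<in>R. idx (r div 2) = d \<and> r mod 2 = i" if "d \<in> M" "i < 2" for d i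
    using ex1_R[of "\<lambda>d'. d' = d" i] that by auto
  \<comment> \<open>Only two codes lie over each point, so three codes cannot share one
    image.\<close>
  have "\<not> card (D ` V) \<le> 1"
  proof
    assume *: "card (D ` V) \<le> 1"
    moreover have "finite (D ` V)" "D ` V \<noteq> {}" using finV V by auto
    ultimately have "card (D ` V) = 1" by (metis One_nat_def card_0_eq le_Suc_eq le_zero_eq)
    then obtain x where x: "D ` V = {x}" by (auto simp: card_1_singleton_iff)
    have "w = w'" if "w \<in> V" "w' \<in> V" "w mod 2 = w' mod 2" for w w'
    proof -
      have "D w = x" "D w' = x" using x that by blast+
      then show ?thesis using D_parity[of w w'] that V by auto
    qed
    then have "inj_on (\<lambda>w. w mod 2) V" by (rule inj_onI)
    then have "card V = card ((\<lambda>w. w mod 2) ` V)" by (simp add: card_image)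
    also have "\<dots> \<le> card {..<2::nat}" by (intro card_mono) auto
    finally show False using V by simp
  qed
  then obtain x y where xy: "x \<in> D ` V" "y \<in> D ` V" "x \<noteq> y"
    using finV card_le_Suc0_iff_eq[of "D ` V"] by auto
  then have xyX: "x \<in> X" "y \<in> X" using V D_in by auto
  obtain C d where C: "d \<in> M" "C \<in> P d" "x \<in> C" "y \<in> C"
    and uniq: "\<And>d' C'. d' \<in> M \<Longrightarrow> C' \<in> P d' \<Longrightarrow> x \<in> C' \<Longrightarrow> y \<in> C' \<Longrightarrow> C' = C"
    using P_pair[OF xyX xy(3)] by blast
  have big_uniq: "C' = C" if "d' \<in> M" "C' \<in> P d'" "V \<subseteq> big C'" for d' C'
    using that xy by (intro uniq[of d']) (auto simp: big_def)
  show ?thesis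
  proof (cases "D ` V \<subseteq> C")
    case True
    have nosmall: False if "r \<in> R" "V' \<in> small (idx (r div 2)) i" "V \<subseteq> V'" for r V' i
    proof -
      have "V' = V" using smallV that by blast
      then have VT: "D ` V \<in> T (idx (r div 2))" using that by (simp add: small_def)
      then have "card (D ` V) = 3" using block idx_in that by blast
      then have "D ` V = C" using True block[OF C(1)] C
        by (intro card_subset_eq) (auto intro: card_ge_0_finite)
      then show False using VT P_T_disjoint C idx_in that by blast
    qed
    obtain r where r: "r \<in> R" "idx (r div 2) = d" using ex_idx[of d 0] C by auto
    have "V \<subseteq> big C" using True V by (auto simp: big_def)
    show ?thesis
    proof (intro ex1I[of _ "big C"] conjI)
      show "big C \<in> (\<Union>r\<in>R. blocks r)" using r C by (auto simp: blocks_def)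
    next
      fix B assume B: "B \<in> (\<Union>r\<in>R. blocks r) \<and> V \<subseteq> B"
      then obtain s where s: "s \<in> R" "B \<in> blocks s" by blast
      then obtain C' where "B = big C'" "C' \<in> P (idx (s div 2))"
        using nosmall B unfolding blocks_def by blast
      then show "B = big C" using big_uniq[OF idx_in[OF s(1)]] B by blast
    qed fact
  next
    case False
    then have nobig: False if "d' \<in> M" "C' \<in> P d'" "V \<subseteq> big C'" for d' C'
      using big_uniq[OF that] that by (auto simp: big_def)
    \<comment> \<open>An image with just the two points x, y would be contained in C.\<close>
    have "card (D ` V) = 3"
    proof (rule ccontr)
      assume "card (D ` V) \<noteq> 3"
      then have "card (D ` V) \<le> 2" using card_image_le[OF finV, of D] V by linarith
      then have "{x, y} = D ` V" using xy finV by (intro card_seteq) auto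
      then show False using False C by auto
    qed
    moreover have "D ` V \<subseteq> X" using D_in V by auto
    moreover have noP: "\<forall>d\<in>M. D ` V \<notin> P d"
    proof
      fix d' assume d': "d' \<in> M"
      show "D ` V \<notin> P d'"
      proof
        assume *: "D ` V \<in> P d'"
        have "V \<subseteq> big (D ` V)" using V by (auto simp: big_def)
        then show False using nobig * d' by blast
      qed
    qed
    then have "{d \<in> M. D ` V \<in> P d} = {}" by blast
    then have "card {d \<in> M. D ` V \<in> P d} \<noteq> 2" by (simp only: card.empty)
    ultimately have "\<exists>!d. d \<in> M \<and> D ` V \<in> T d" using triple[of "D ` V"] by auto
    then obtain d' where d': "d' \<in> M" "D ` V \<in> T d'" by blast
    obtain r where r: "r \<in> R" "idx (r div 2) = d'" "r mod 2 = \<Sum>V mod 2"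
      using ex_idx[of d' "\<Sum>V mod 2"] d' by auto
    have "V \<in> blocks r" using r d' V by (auto simp: blocks_def small_def)
    show ?thesis
    proof (intro ex1I[of _ V] conjI)
      show "V \<in> (\<Union>r\<in>R. blocks r)" using r \<open>V \<in> blocks r\<close> by blast
    next
      fix B assume B: "B \<in> (\<Union>r\<in>R. blocks r) \<and> V \<subseteq> B"
      then obtain s where s: "s \<in> R" "B \<in> blocks s" by blast
      then have "B \<in> small (idx (s div 2)) (s mod 2)"
        using nobig[OF idx_in[OF s(1)]] B unfolding blocks_def by blast
      then show "B = V" using smallV B by blast
    qed simp
  qed
qed

text \<open>For a 6-block two indices d times two parities give 4 = 6 - 2; for a transversal one d
  and one parity give 1 = 3 - 2.\<close>

lemma card_block_index:
  assumes "r \<in> R" "B \<in> blocks r"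
  shows "card {r\<in>R. B \<in> blocks r} = card B - 2"
  using assms
proof (cases rule: block_cases)
  case (big C)
  have "B \<in> blocks s \<longleftrightarrow> C \<in> P (idx (s div 2))" if "s \<in> R" for s
  proof
    assume *: "B \<in> blocks s"
    obtain C' where C': "B = big C'" "C' \<in> P (idx (s div 2))" "C' \<subseteq> X"
      by (rule block_cases[OF \<open>s \<in> R\<close> *]) (use big in auto)
    then have "C' = C" using D_image_big big by metis
    then show "C \<in> P (idx (s div 2))" using C' by simp
  qed (use big in \<open>auto simp: blocks_def\<close>)
  then have "{r\<in>R. B \<in> blocks r} = {r\<in>R. C \<in> P (idx (r div 2))}" by blast
  then show ?thesis
    using card_R[of "\<lambda>d. C \<in> P d"] card_P_blocks[OF idx_in, of r C] assms big by simp
next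
  case small
  have "B \<in> blocks s \<longleftrightarrow> D ` B \<in> T (idx (s div 2)) \<and> s mod 2 = \<Sum>B mod 2" if "s \<in> R" for s
  proof
    assume "B \<in> blocks s"
    then show "D ` B \<in> T (idx (s div 2)) \<and> s mod 2 = \<Sum>B mod 2"
      using small by (cases rule: block_cases[OF that]) (auto simp: small_def)
  qed (use small in \<open>auto simp: blocks_def small_def\<close>)
  then have "{r\<in>R. B \<in> blocks r} = {r\<in>R. D ` B \<in> T (idx (r div 2)) \<and> r mod 2 = \<Sum>B mod 2}"
    by blast
  moreover have "card {r\<in>R. D ` B \<in> T (idx (r div 2)) \<and> r mod 2 = \<Sum>B mod 2} = 1"
    by (rule card_Collect_ex1, rule ex1_R[OF ex1_T[OF idx_in[OF assms(1)] small(3)]]) simp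
  ultimately show ?thesis using small(2) by simp
qed

section \<open>The digraphs seen from the points at infinity\<close>

definition "S = {2..<2 * card X}"

text \<open>The summand for \<open>w < w'\<close> makes exactly one of the arcs (w, w') and (w', w)
  occur for given r, and a change of the parity of r reverses every arc.\<close>

definition arcs :: "nat \<Rightarrow> (nat \<times> nat) set" where
  "arcs r = {(w, w'). w \<in> W \<and> w' \<in> W \<and> {D 0, D w, D w'} \<in> T (idx (r div 2)) \<and>
     even (w + w' + r + (if w < w' then 1 else 0))}"

definition flip :: "nat \<Rightarrow> nat" where "flip w = (if even w then w + 1 else w - 1)"

lemma W_eq: "W = S \<union> {0, 1}" "0 \<in> W" "1 \<in> W"
  using card_X by (auto simp: W_def S_def)

lemma flip: "w \<in> W \<Longrightarrow> flip w \<in> W" "D (flip w) = D w" "even (flip w) = odd w" "flip (flip w) = w"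
proof -
  have div: "flip w div 2 = w div 2" unfolding flip_def by (cases "even w") (auto elim: oddE)
  show "D (flip w) = D w" by (simp add: D_def div)
  show "w \<in> W \<Longrightarrow> flip w \<in> W" by (auto simp: W_def flip_def elim!: evenE)
  show "even (flip w) = odd w" "flip (flip w) = w"
    by (auto simp: flip_def elim!: oddE)
qed

lemma card3_neq: "card {a, b, c} = 3 \<Longrightarrow> a \<noteq> b \<and> a \<noteq> c \<and> b \<noteq> c"
  by (auto simp: card_insert_if split: if_splits)

lemma T_neq: "r \<in> R \<Longrightarrow> {a, b, c} \<in> T (idx (r div 2)) \<Longrightarrow> a \<noteq> b \<and> a \<noteq> c \<and> b \<noteq> c"
proof (rule card3_neq)
  assume "r \<in> R" "{a, b, c} \<in> T (idx (r div 2))"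
  then show "card {a, b, c} = 3" using block[OF idx_in, of r "{a, b, c}"] by (metis UnI2)
qed

lemma in_S: "w \<in> W \<Longrightarrow> D 0 \<noteq> D w \<Longrightarrow> w \<in> S"
  using W_eq by (auto simp: D_def)

lemma S_neq: "w \<in> S \<Longrightarrow> D 0 \<noteq> D w" "w \<in> S \<Longrightarrow> w \<in> W"
  using D_eq[of 0 w] W_eq by (auto simp: S_def)

lemma arcs_S:
  assumes "r \<in> R" "(w, w') \<in> arcs r" shows "w \<in> S" "w' \<in> S" "w \<noteq> w'" "D w \<noteq> D w'"
  using assms T_neq[of r "D 0" "D w" "D w'"] by (auto simp: arcs_def intro!: in_S)

text \<open>This exhibits the directed 4-cycle w, w', \<open>flip w\<close>, \<open>flip w'\<close>.
  Copies of one point have consecutive codes, so \<open>flip\<close> does not affect comparisons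
  between copies of different points. Passing from (w, w') to (\<open>flip w'\<close>, w) therefore
  changes the level sum and the comparison, and the two changes cancel modulo 2.\<close>

lemma arcs_flip:
  assumes "r \<in> R" shows "(w, w') \<in> arcs r \<longleftrightarrow> (flip w', w) \<in> arcs r"
proof -
  have step: "(flip w', w) \<in> arcs r" if "(w, w') \<in> arcs r" for w w'
  proof -
    have neq: "D w \<noteq> D w'" by (rule arcs_S[OF assms that])
    then have "w div 2 \<noteq> w' div 2" by (auto simp: D_def)
    then have "flip w' < w \<longleftrightarrow> \<not> w < w'" by (auto simp: flip_def elim!: oddE evenE)
    then show ?thesis using that flip by (auto simp: arcs_def insert_commute split: if_splits)
  qed
  show ?thesis by (metis step flip(4))
qed

text \<open>Following the 4-cycle one step, (w, w') to (w', \<open>flip w\<close>), maps the arcs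
  into x bijectively to the arcs out of x. This survives unions over several r.\<close>

lemma eulerian:
  assumes "g \<subseteq> R"
  shows "eulerian_digraph \<lparr>pverts = S, parcs = \<Union>r\<in>g. arcs r\<rparr>"
proof -
  let ?A = "\<Union>r\<in>g. arcs r"
  have subD: "a \<in> S" "b \<in> S" if "r \<in> g" "(a, b) \<in> arcs r" for a b r
    using that assms by (auto dest: arcs_S)
  have sub: "?A \<subseteq> S \<times> S" using assms by (auto dest: arcs_S)
  have ne: "(w, w) \<notin> ?A" for w using assms by (auto dest: arcs_S(3))
  have fin: "finite S" by (simp add: S_def)
  have flipA: "(w, w') \<in> ?A \<longleftrightarrow> (flip w', w) \<in> ?A" for w w'
    using arcs_flip assms by blast
  have flipA': "(w', flip w) \<in> ?A \<longleftrightarrow> (w, w') \<in> ?A" for w w'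
    using flipA[of w' "flip w"] by (simp add: flip)
  have "card {e \<in> ?A. snd e = x} = card {e \<in> ?A. fst e = x}" for x
  proof (rule bij_betw_same_card[of "\<lambda>(w, w'). (w', flip w)"])
    show "bij_betw (\<lambda>(w, w'). (w', flip w)) {e \<in> ?A. snd e = x} {e \<in> ?A. fst e = x}"
      by (rule bij_betw_byWitness[of _ "\<lambda>(w, w'). (flip w', w)"])
        (use flipA flipA' flip(4) in \<open>auto simp del: UN_iff\<close>)
  qed
  then show ?thesis
    using subD ne fin finite_subset[OF sub]
    by (auto simp: eulerian_digraph_def in_degree_def out_degree_def in_arcs_def out_arcs_def
        intro!: pair_digraph.intro pair_fin_digraph.intro pair_wf_digraph.intro
        pair_fin_digraph_axioms.intro pair_loopfree_digraph.intro pair_loopfree_digraph_axioms.intro)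
qed

text \<open>Exactly one of the codes 0 and 1, namely \<open>(x + y + r) mod 2\<close>, completes x
  and y to a transversal of the parity of r. Hence all four edges between the copies of two suitable
  points are present for either parity.\<close>

lemma edges:
  assumes "r \<in> R"
  shows "(\<exists>i\<in>{0, 1}. {i, x, y} \<in> blocks r) \<and> x \<in> S \<and> y \<in> S \<longleftrightarrow> (x, y) \<in> arcs r \<or> (y, x) \<in> arcs r"
proof
  assume *: "(\<exists>i\<in>{0, 1}. {i, x, y} \<in> blocks r) \<and> x \<in> S \<and> y \<in> S"
  then obtain i where i: "i \<in> {0, 1}" "{i, x, y} \<in> blocks r" by blast
  \<comment> \<open>The size rules out a 6-block.\<close>
  have "card {i, x, y} \<le> 3" by (simp add: card_insert_if)
  then have "D ` {i, x, y} \<in> T (idx (r div 2))"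
    using block_cases[OF assms i(2)] by fastforce
  then have "{D 0, D x, D y} \<in> T (idx (r div 2))" using i(1) by (auto simp: D_def)
  moreover from this have "x < y \<longleftrightarrow> \<not> y < x"
    using T_neq[OF assms, of "D 0" "D x" "D y"] by (metis less_asym' linorder_neqE_nat)
  ultimately show "(x, y) \<in> arcs r \<or> (y, x) \<in> arcs r"
    using * W_eq by (auto simp: arcs_def insert_commute)
next
  have "(\<exists>i\<in>{0, 1}. {i, x, y} \<in> blocks r) \<and> x \<in> S \<and> y \<in> S" if xy: "(x, y) \<in> arcs r" for x y
  proof -
    define i where "i = (x + y + r) mod 2"
    have i: "i \<in> {0, 1}" "D i = D 0" "i \<in> W" using W_eq by (auto simp: i_def D_def)
    have S: "x \<in> S" "y \<in> S" "x \<noteq> y" using arcs_S[OF assms xy] by auto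
    then have "i \<noteq> x" "i \<noteq> y" using i by (auto simp: S_def)
    moreover have "(i + (x + y)) mod 2 = r mod 2" unfolding i_def by (auto simp: mod2_eq_if)
    ultimately have "{i, x, y} \<in> small (idx (r div 2)) (r mod 2)"
      using i xy S W_eq by (auto simp: small_def arcs_def)
    then show ?thesis using i S by (auto simp: blocks_def)
  qed
  then show "(\<exists>i\<in>{0, 1}. {i, x, y} \<in> blocks r) \<and> x \<in> S \<and> y \<in> S"
    if "(x, y) \<in> arcs r \<or> (y, x) \<in> arcs r"
    using that by (metis insert_commute)
qed

text \<open>By the hypothesis the points \<open>D 0\<close>, \<open>D x\<close>, \<open>D y\<close>
  lie in no common class block, so they form a triple of a unique \<open>T d\<close>. The parity
  condition in \<open>arcs\<close> then admits one of the two members of d.\<close>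

lemma ex1_arc:
  assumes xy: "x \<in> S" "y \<in> S" "x \<noteq> y"
    and no_block: "\<And>r B. r \<in> R \<Longrightarrow> B \<in> blocks r \<Longrightarrow> {0, 1} \<subseteq> B \<Longrightarrow> \<not> {x, y} \<subseteq> B"
  shows "\<exists>!r. r \<in> R \<and> (x, y) \<in> arcs r"
proof -
  have W: "x \<in> W" "y \<in> W" using xy W_eq by auto
  have D01: "D 1 = D 0" by (simp add: D_def)
  have noP: "\<not> {D 0, D x, D y} \<subseteq> C" if "d \<in> M" "C \<in> P d" for d C
  proof
    assume C: "{D 0, D x, D y} \<subseteq> C"
    have "\<exists>r. r \<in> R \<and> idx (r div 2) = d" using ex1_R[of "\<lambda>d'. d' = d" 0] that(1) by auto
    then obtain r where r: "r \<in> R" "idx (r div 2) = d" by blast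
    have "big C \<in> blocks r" using that r by (auto simp: blocks_def)
    moreover have "{0, 1} \<subseteq> big C" "{x, y} \<subseteq> big C" using C W W_eq D01 by (auto simp: big_def)
    ultimately show False using no_block r by blast
  qed
  \<comment> \<open>Otherwise the class block through \<open>D 0\<close> and \<open>D x\<close>
    would give a 6-block containing 0, 1, x and y.\<close>
  have "D x \<noteq> D y"
  proof
    assume eq: "D x = D y"
    obtain d where d: "d \<in> M"
      using card_X xy by (cases "M = {}") (auto simp: S_def)
    show False using P_pair[of "D 0" "D x"] noP eq S_neq[OF xy(1)] W W_eq D_in
      by (metis empty_subsetI insert_subset)
  qed
  then have card: "card {D 0, D x, D y} = 3" using S_neq xy by auto
  then have "\<exists>!d. d \<in> M \<and> {D 0, D x, D y} \<in> T d"
  proof -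
    have "{D 0, D x, D y} \<subseteq> X" using D_in W W_eq by auto
    moreover have "{d\<in>M. {D 0, D x, D y} \<in> P d} = {}" using noP by blast
    then have "card {d\<in>M. {D 0, D x, D y} \<in> P d} \<noteq> 2" by (simp only: card.empty)
    ultimately show ?thesis using triple[OF _ card] by blast
  qed
  then have "\<exists>!r. r \<in> R \<and> {D 0, D x, D y} \<in> T (idx (r div 2)) \<and>
      r mod 2 = (x + y + (if x < y then 1 else 0)) mod 2"
    by (rule ex1_R) simp
  moreover have "even (x + y + r + (if x < y then 1 else 0)) \<longleftrightarrow>
    r mod 2 = (x + y + (if x < y then 1 else 0)) mod 2" for r
    by (auto simp: mod2_eq_if)
  ultimately show ?thesis using W by (simp add: arcs_def)
qed

section \<open>Merging members\<close>

lemma size_filter_mset_sum: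
  "finite A \<Longrightarrow> size (filter_mset Q (\<Sum>r\<in>A. f r)) = (\<Sum>r\<in>A. size (filter_mset Q (f r)))"
  by (induction A rule: finite_induct) simp_all

text \<open>
  The blocks and the digraph of several indices \<open>r\<close> can be merged: singletons \<open>g k\<close> give the
  system with \<open>\<lambda> = 1\<close>, and pairs \<open>{2 * k, 2 * k + 1}\<close> the one with \<open>\<lambda> = 2\<close>.
\<close>

lemma GLS_merge:
  fixes g :: "nat \<Rightarrow> nat set"
  assumes I: "finite I" "disjoint_family_on g I" "(\<Union>k\<in>I. g k) = R"
    and card_g: "\<And>k. k \<in> I \<Longrightarrow> card (g k) = l"
  shows "GLS l {3, 6} {6} (2 * card X) S 0 1 I (\<lambda>k. \<Sum>r\<in>g k. mset_set (blocks r))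
    (\<lambda>k. \<lparr>pverts = S, parcs = \<Union>r\<in>g k. arcs r\<rparr>)"
proof -
  let ?B = "\<lambda>k. \<Sum>r\<in>g k. mset_set (blocks r)"
  let ?K = "{3, 6} \<union> {3} \<union> {6} :: nat set"
  have gR: "g k \<subseteq> R" if "k \<in> I" for k using I that by blast
  have fin_g: "finite (g k)" if "k \<in> I" for k using gR[OF that] finite_R finite_subset by blast
  have mem: "B \<in># ?B k \<longleftrightarrow> (\<exists>r\<in>g k. B \<in> blocks r)" if "k \<in> I" for k B
    using fin_g[OF that] gR[OF that] finite_blocks by (force simp: set_mset_sum)
  have mem_all: "(\<Union>k\<in>I. set_mset (?B k)) = (\<Union>r\<in>R. blocks r)"
    using mem by (auto simp flip: I(3))
  have K: "B \<subseteq> S \<union> {0, 1} \<and> card B \<in> ?K" if k: "k \<in> I" and B: "B \<in># ?B k" for k B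
  proof -
    obtain r where "r \<in> R" "B \<in> blocks r" using mem[OF k, of B] gR[OF k] B by blast
    then show ?thesis using block_sub W_eq by (auto elim!: block_cases)
  qed
  have pairs: "size {#B \<in># ?B k. p \<subseteq> B#} = l" if k: "k \<in> I" and p: "p \<subseteq> S \<union> {0, 1}" "card p = 2" for k p
  proof -
    obtain w w' where w: "p = {w, w'}" "w \<noteq> w'" using p by (auto simp: card_2_iff)
    have "size {#B \<in># mset_set (blocks r). p \<subseteq> B#} = 1" if "r \<in> g k" for r
    proof -
      have r: "r \<in> R" using gR k that by blast
      then have "card {B \<in> blocks r. p \<subseteq> B} = 1"
        using card_Collect_ex1[OF ex1_block_pair[OF r, of w w']] w p W_eq by simp
      then show ?thesis using finite_blocks[OF r] by simp
    qed
    then show ?thesis using card_g[OF k] by (simp add: size_filter_mset_sum fin_g[OF k])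
  qed
  have S2: "S2 l ?K (2 * card X) (S \<union> {0, 1}) (?B k)" if "k \<in> I" for k
    using K[OF that] pairs[OF that] card_W finite_W W_eq by (simp add: S2_def)
  have S2_012: "S2_012 l {3, 6} {3} {6} (2 * card X) S 0 1 (?B k)" if k: "k \<in> I" for k
    unfolding S2_012_def
  proof (intro conjI allI impI S2[OF k])
    show "card S + 2 = 2 * card X" using card_X by (simp add: S_def)
  next
    fix B assume B: "B \<in># ?B k"
    then obtain r where r: "r \<in> R" "B \<in> blocks r" using mem[OF k, of B] gR[OF k] by blast
    \<comment> \<open>Because of this a 6-block contains both points at infinity or neither, and a
      transversal contains at most one.\<close>
    have D01: "D 0 = D 1" by (simp add: D_def)
    show "card B \<in> {3, 6}" using r by (rule block_cases) simp_all
    show "card B \<in> {3}" if "card (B \<inter> {0, 1}) = 1"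
      using r
    proof (rule block_cases)
      fix C assume "B = big C"
      then have "0 \<in> B \<longleftrightarrow> 1 \<in> B" using W_eq D01 by (simp add: big_def)
      then have "card (B \<inter> {0, 1}) \<noteq> 1" by (cases "0 \<in> B") (simp_all add: Int_insert_right)
      then show ?thesis using that by contradiction
    qed simp
    show "card B \<in> {6}" if "card (B \<inter> {0, 1}) = 2"
      using r
    proof (rule block_cases)
      assume "inj_on D B"
      then have "\<not> (0 \<in> B \<and> 1 \<in> B)" using inj_onD[of D B 0 1] D01 by auto
      then have "card (B \<inter> {0, 1}) \<noteq> 2" by (auto simp: Int_insert_right)
      then show ?thesis using that by contradiction
    qed simp
  qed (auto simp: S_def)
  have LS: "LS l ?K (2 * card X) (S \<union> {0, 1}) I ?B"
    unfolding LS_def mem_all S3_def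
  proof (intro conjI ballI allI impI S2 I(1))
    fix B assume "B \<in> (\<Union>r\<in>R. blocks r)"
    then obtain r where r: "r \<in> R" "B \<in> blocks r" by blast
    have "count (\<Sum>k\<in>I. ?B k) B = (\<Sum>k\<in>I. \<Sum>r\<in>g k. count (mset_set (blocks r)) B)"
      by (simp add: count_sum)
    also have "\<dots> = (\<Sum>r\<in>(\<Union>k\<in>I. g k). count (mset_set (blocks r)) B)"
      using I fin_g by (intro sum.UNION_disjoint[symmetric]) (auto simp: disjoint_family_on_def)
    also have "\<dots> = (\<Sum>r\<in>R. if B \<in> blocks r then 1 else 0)"
      unfolding I by (intro sum.cong refl) (simp add: count_mset_set' finite_blocks)
    also have "\<dots> = card {r\<in>R. B \<in> blocks r}"
      by (simp add: sum.If_cases finite_R Int_def)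
    also have "\<dots> = card B - 2" using card_block_index r by blast
    finally show "count (\<Sum>k\<in>I. ?B k) B = card B - 2" .
    show "B \<subseteq> S \<union> {0, 1}" "card B \<in> ?K"
      using r block_sub W_eq by (auto elim!: block_cases)
  next
    fix V assume "V \<subseteq> S \<union> {0, 1} \<and> card V = 3"
    then show "\<exists>!B. B \<in> (\<Union>r\<in>R. blocks r) \<and> V \<subseteq> B" using ex1_block_triple W_eq by simp
  qed (use finite_W card_W W_eq in auto)
  have GS: "GS l {3, 6} {6} (2 * card X) S 0 1 (?B k) \<lparr>pverts = S, parcs = \<Union>r\<in>g k. arcs r\<rparr>"
    if k: "k \<in> I" for k
  proof -
    have e: "x \<in> S \<and> y \<in> S \<and> (\<exists>i\<in>{0, 1}. {i, x, y} \<in># ?B k) \<longleftrightarrow>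
        (\<exists>r\<in>g k. (x, y) \<in> arcs r \<or> (y, x) \<in> arcs r)" for x y
      using edges[of _ x y] gR[OF k] unfolding mem[OF k] by blast
    have "{{x, y} |x y. (x, y) \<in> (\<Union>r\<in>g k. arcs r)} =
      {{x, y} |x y. \<exists>r\<in>g k. (x, y) \<in> arcs r \<or> (y, x) \<in> arcs r}" by blast
    also have "\<dots> = {{x, y} |x y. x \<in> S \<and> y \<in> S \<and> (\<exists>i\<in>{0, 1}. {i, x, y} \<in># ?B k)}"
      by (simp only: e)
    finally show ?thesis
      using S2_012[OF k] eulerian[OF gR[OF k]] by (simp add: GS_def underlying_edges_def)
  qed
  have "\<exists>!k. k \<in> I \<and> (x, y) \<in> (\<Union>r\<in>g k. arcs r)"
    if xy: "x \<in> S" "y \<in> S" "x \<noteq> y"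
      and no: "\<not> (\<exists>k\<in>I. \<exists>B. B \<in># ?B k \<and> {0, 1} \<subseteq> B \<and> {x, y} \<subseteq> B)" for x y
  proof -
    have "\<not> {x, y} \<subseteq> B" if r: "r \<in> R" "B \<in> blocks r" and B: "{0, 1} \<subseteq> B" for r B
    proof -
      obtain k where k: "k \<in> I" "r \<in> g k" using r(1) I(3) by blast
      then have "B \<in># ?B k" using r mem[OF k(1), of B] by blast
      then show ?thesis using no k(1) B by blast
    qed
    then obtain r where r: "r \<in> R" "(x, y) \<in> arcs r"
      and uniq: "\<And>s. s \<in> R \<Longrightarrow> (x, y) \<in> arcs s \<Longrightarrow> s = r"
      using ex1_arc[OF xy] by blast
    obtain k where k: "k \<in> I" "r \<in> g k" using r I by blast
    show ?thesis
    proof (rule ex1I[of _ k])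
      fix k' assume k': "k' \<in> I \<and> (x, y) \<in> (\<Union>r\<in>g k'. arcs r)"
      then have "r \<in> g k'" using uniq gR by blast
      then show "k' = k" using k k' I(2) unfolding disjoint_family_on_def by blast
    qed (use k r in blast)
  qed
  then show ?thesis using GS LS S2_012 unfolding GLS_def LS_012_def by simp
qed

lemma ex_GLS:
  "(\<exists>(S :: nat set) p q (R :: nat set) \<B> D. GLS 1 {3, 6} {6} (2 * card X) S p q R \<B> D) \<and>
   (\<exists>(S :: nat set) p q (R :: nat set) \<B> D. GLS_star 2 {3, 6} {6} (2 * card X) S p q R \<B> D)"
proof
  have "GLS 1 {3, 6} {6} (2 * card X) S 0 1 R (\<lambda>k. \<Sum>r\<in>{k}. mset_set (blocks r))
    (\<lambda>k. \<lparr>pverts = S, parcs = \<Union>r\<in>{k}. arcs r\<rparr>)"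
    by (rule GLS_merge) (auto simp: disjoint_family_on_def finite_R)
  then show "\<exists>(S :: nat set) p q (R :: nat set) \<B> D. GLS 1 {3, 6} {6} (2 * card X) S p q R \<B> D"
    by blast
next
  let ?g = "\<lambda>k. {2 * k, 2 * k + 1 :: nat}" and ?I = "{..<card M}"
  let ?B = "\<lambda>k. \<Sum>r\<in>?g k. mset_set (blocks r)"
  have "(\<Union>k\<in>?I. ?g k) = R"
  proof
    show "R \<subseteq> (\<Union>k\<in>?I. ?g k)"
    proof
      fix r assume "r \<in> R"
      then have "r div 2 \<in> ?I" "r \<in> ?g (r div 2)" by (auto simp: R_def)
      then show "r \<in> (\<Union>k\<in>?I. ?g k)" by blast
    qed
  qed (auto simp: R_def)
  then have GLS: "GLS 2 {3, 6} {6} (2 * card X) S 0 1 ?I ?B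
      (\<lambda>k. \<lparr>pverts = S, parcs = \<Union>r\<in>?g k. arcs r\<rparr>)"
    by (intro GLS_merge) (auto simp: disjoint_family_on_def)
  \<comment> \<open>Blocks with at least four points are 6-blocks. These depend on d but not on the
    parity, so both merged members contribute one copy.\<close>
  have "count (?B k) B = 2" if k: "k \<in> ?I" and B: "B \<in># ?B k" "card B \<ge> 4" for k B
  proof -
    have R: "2 * k \<in> R" "2 * k + 1 \<in> R" using k by (auto simp: R_def)
    then obtain r where r: "r \<in> R" "r div 2 = k" "B \<in> blocks r"
      using B finite_blocks by auto
    from r(1,3) obtain C where C: "B = big C" "C \<in> P (idx k)"
      by (rule block_cases) (use B r in auto)
    then have "B \<in> blocks (2 * k)" "B \<in> blocks (2 * k + 1)" by (auto simp: blocks_def)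
    then show ?thesis using R finite_blocks by simp
  qed
  then have "GLS_star 2 {3, 6} {6} (2 * card X) S 0 1 ?I ?B
      (\<lambda>k. \<lparr>pverts = S, parcs = \<Union>r\<in>?g k. arcs r\<rparr>)"
    using GLS unfolding GLS_star_def LS_012_star_def LS_star_def GLS_def LS_012_def by blast
  then show "\<exists>(S :: nat set) p q (R :: nat set) \<B> D. GLS_star 2 {3, 6} {6} (2 * card X) S p q R \<B> D"
    by blast
qed

end

theorem (in large_set) ex_GLS:
  "(\<exists>(S :: nat set) p q (R :: nat set) \<B> D. GLS 1 {3, 6} {6} (2 * card X) S p q R \<B> D) \<and>
   (\<exists>(S :: nat set) p q (R :: nat set) \<B> D. GLS_star 2 {3, 6} {6} (2 * card X) S p q R \<B> D)"
proof -
  obtain pnt where "bij_betw pnt {..<card X} X"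
    using ex_bij_betw_nat_finite[OF finite_X] by (auto simp: atLeast0LessThan)
  moreover obtain idx where "bij_betw idx {..<card M} M"
    using ex_bij_betw_nat_finite[OF finite_M] by (auto simp: atLeast0LessThan)
  ultimately interpret doubling X M P T pnt idx by unfold_locales
  show ?thesis by (rule ex_GLS)
qed

section \<open>Vectors and lines\<close>

lemma card_3_obtain:
  assumes "card B = 3"
  obtains x y z where "B = {x, y, z}" "x \<noteq> y" "x \<noteq> z" "y \<noteq> z"
  using assms by (auto simp: card_3_iff)

text \<open>As the dimension n is a variable, the space is modelled as a finite additive subgroup of
  one fixed ring. Scalars of a prime field act as integers, so closure under subtraction already
  gives closure under scalars.\<close>

locale fin_subgroup =
  fixes G :: "'v :: comm_ring_1 set"
  assumes finite_G: "finite G" and zero_G: "0 \<in> G"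
    and diff_G: "x \<in> G \<Longrightarrow> y \<in> G \<Longrightarrow> x - y \<in> G"
begin

lemma minus_G: "x \<in> G \<Longrightarrow> - x \<in> G"
  using diff_G[OF zero_G] by simp

lemma add_G: "x \<in> G \<Longrightarrow> y \<in> G \<Longrightarrow> x + y \<in> G"
  using diff_G[of x "- y"] minus_G by simp

lemma of_int_mult_G:
  assumes "x \<in> G" shows "of_int c * x \<in> G"
proof -
  have nat: "of_nat k * x \<in> G" for k
    by (induction k) (use assms zero_G add_G in \<open>auto simp: algebra_simps\<close>)
  show ?thesis
    using nat minus_G[OF nat] by (cases c rule: int_cases2) auto
qed

end

text \<open>Three distinct points have sum 0 exactly when they form a line, and a line has the two
  directions d and -d, hence lies in two classes. For a pair x, y the only candidate in
  \<open>T d\<close> has third point d - x - y. This coincides with x or y exactly if y is x + d or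
  x - d, that is, if the line of direction d through x already covers the pair.\<close>

lemma (in fin_subgroup) large_set_char_3:
  assumes char: "3 = (0 :: 'v)"
  shows "large_set G (G - {0}) (\<lambda>d. (\<lambda>x. {x, x + d, x - d}) ` G)
    (\<lambda>d. {B. B \<subseteq> G \<and> card B = 3 \<and> \<Sum>B = d})"
proof
  let ?M = "G - {0}"
  let ?P = "\<lambda>d. (\<lambda>x. {x, x + d, x - d}) ` G"
  let ?T = "\<lambda>d. {B. B \<subseteq> G \<and> card B = 3 \<and> \<Sum>B = d}"
  \<comment> \<open>Characteristic 3 enters through this identity: doubling is negation.\<close>
  have dd: "x + x = - x" for x :: 'v
  proof -
    have "x + x + x = 3 * x" by simp
    then show ?thesis by (simp add: char eq_neg_iff_add_eq_0)
  qed
  have double: "x - y = y - x \<longleftrightarrow> x = y" for x y :: 'v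
  proof
    assume "x - y = y - x"
    then have "(x - y) + (x - y) = x - y" unfolding dd by simp
    then show "x = y" by (simp only: add_cancel_left_right right_minus_eq)
  qed simp
  have P_distinct: "x \<noteq> x + d" "x \<noteq> x - d" "x + d \<noteq> x - d" if "d \<noteq> 0" for x d :: 'v
    using that double[of "x + d" x] by auto
  show "finite G" "finite ?M" by (simp_all add: finite_G)
  show "card G = card ?M + 1" using finite_G zero_G by (metis Suc_eq_plus1 card.remove)
  show "B \<subseteq> G \<and> card B = 3" if "d \<in> ?M" "B \<in> ?P d \<union> ?T d" for d B
    using that P_distinct[of d] add_G diff_G by auto
  have line_mem: "{x, x + d, x - d} = {y, y + d, y - d}" if "y \<in> {x, x + d, x - d}" for x y d :: 'v
  proof -
    have "x + d + d = x - d" "x - d - d = x + d" by (simp_all only: add.assoc diff_diff_eq dd add_uminus_conv_diff diff_minus_eq_add)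
    then show ?thesis using that by auto
  qed
  have P_eq: "B = {x, x + d, x - d}" if "B \<in> ?P d" "x \<in> B" for B x d
    using that line_mem by auto
  show "\<exists>!B. B \<in> ?P d \<and> x \<in> B" if "d \<in> ?M" "x \<in> G" for d x
    using that P_eq by (intro ex1I[of _ "{x, x + d, x - d}"]) blast+
  show "\<exists>!B. B \<in> ?P d \<union> ?T d \<and> x \<in> B \<and> y \<in> B"
    if d: "d \<in> ?M" and x: "x \<in> G" and y: "y \<in> G" and xy: "x \<noteq> y" for d x y
  proof -
    have T_eq: "B = {x, y, d - x - y} \<and> d - x - y \<noteq> x \<and> d - x - y \<noteq> y"
      if B: "B \<in> ?T d" "x \<in> B" "y \<in> B" for B
    proof -
      have "finite B" "card (B - {x, y}) = 1"
        using B xy by (auto simp: card_Diff_subset intro: card_ge_0_finite)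
      then obtain z where "B - {x, y} = {z}" by (auto simp: card_1_singleton_iff)
      then have z: "B = {x, y, z}" "z \<noteq> x" "z \<noteq> y" using B by auto
      then have "z = d - x - y" using B xy by (auto simp: algebra_simps)
      then show ?thesis using z by simp
    qed
    have "d - x - y = x \<longleftrightarrow> y = d - (x + x)" "d - x - y = y \<longleftrightarrow> d - x = y + y"
      by (auto simp: algebra_simps)
    then have third: "d - x - y = x \<longleftrightarrow> y = x + d" "d - x - y = y \<longleftrightarrow> y = x - d"
      unfolding dd by (auto simp: algebra_simps)
    show ?thesis
    proof (cases "y = x + d \<or> y = x - d")
      case True
      then have noT: "B \<notin> ?T d" if "x \<in> B" "y \<in> B" for B
        using T_eq[of B] third that by blast
      show ?thesis
      proof (rule ex1I[of _ "{x, x + d, x - d}"])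
        fix B assume "B \<in> ?P d \<union> ?T d \<and> x \<in> B \<and> y \<in> B"
        then show "B = {x, x + d, x - d}" using noT[of B] P_eq[of B d x] by (elim conjE UnE) simp_all
      qed (use x True in auto)
    next
      case False
      have noP: "B \<notin> ?P d" if "x \<in> B" "y \<in> B" for B
      proof
        assume "B \<in> ?P d"
        then have "B = {x, x + d, x - d}" using that(1) by (rule P_eq)
        then show False using that(2) False xy by simp
      qed
      show ?thesis
      proof (rule ex1I[of _ "{x, y, d - x - y}"])
        have ne: "d - x - y \<noteq> x" "d - x - y \<noteq> y" using False third by blast+
        have "card {x, y, d - x - y} = 3" using ne[symmetric] xy by simp
        moreover have "\<Sum>{x, y, d - x - y} = x + (y + (d - x - y))" using ne[symmetric] xy by simp
        moreover have "d - x - y \<in> G" using d x y diff_G by blast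
        ultimately have "{x, y, d - x - y} \<in> ?T d" using x y by (simp add: algebra_simps)
        then show "{x, y, d - x - y} \<in> ?P d \<union> ?T d \<and> x \<in> {x, y, d - x - y} \<and> y \<in> {x, y, d - x - y}"
          by blast
        fix B assume "B \<in> ?P d \<union> ?T d \<and> x \<in> B \<and> y \<in> B"
        then show "B = {x, y, d - x - y}" using noP[of B] T_eq[of B] by (elim conjE UnE) simp_all
      qed
    qed
  qed
  fix B :: "'v set" assume B: "B \<subseteq> G" "card B = 3"
  then obtain x y z where xyz: "B = {x, y, z}" "x \<noteq> y" "x \<noteq> z" "y \<noteq> z"
    by (rule_tac card_3_obtain)
  have G: "x \<in> G" "y \<in> G" "z \<in> G" using B xyz by auto
  have sum: "\<Sum>B = x + y + z" using xyz by (simp add: add.assoc)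
  have P_sum: "\<Sum>B' = 0" if d: "d \<in> ?M" "B' \<in> ?P d" for d B'
  proof -
    obtain w where w: "B' = {w, w + d, w - d}" using d by blast
    then have "\<Sum>B' = w + (w + d + (w - d))" using P_distinct[of d w] d by simp
    also have "\<dots> = w + w + w" by (simp only: algebra_simps diff_add_cancel)
    finally show ?thesis by (simp only: dd left_minus)
  qed
  show "card {d \<in> ?M. B \<in> ?P d} = 2 \<and> (\<forall>d\<in>?M. B \<notin> ?T d) \<or>
    (\<forall>d\<in>?M. B \<notin> ?P d) \<and> (\<exists>!d. d \<in> ?M \<and> B \<in> ?T d)"
  proof (cases "\<Sum>B = 0")
    case True
    \<comment> \<open>Read from x, the line has y as x + d or x - d, so its direction is fixed up to
      sign.\<close>
    have "d \<in> {y - x, x - y}" if "d \<in> ?M" "B \<in> ?P d" for d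
    proof -
      have "B = {x, x + d, x - d}" using P_eq[OF that(2), of x] xyz(1) by blast
      then show ?thesis using xyz(1,2) by auto
    qed
    moreover have "B \<in> ?P d" if "d = y - x \<or> d = x - y" for d
    proof -
      have "z = (- x) - y" using True sum by (simp add: eq_neg_iff_add_eq_0 algebra_simps)
      then have "z = x - (y - x)" "z = x + (x - y)" unfolding dd[symmetric] by simp_all
      then have "B = {x, x + d, x - d}" using that xyz(1) by auto
      then show ?thesis using G by blast
    qed
    ultimately have "{d \<in> ?M. B \<in> ?P d} = {y - x, x - y}"
      using xyz G diff_G by auto
    then show ?thesis using True xyz double[of y x] by auto
  next
    case False
    have "\<Sum>B \<in> G" using G add_G sum by simp
    then have "\<exists>!d. d \<in> ?M \<and> B \<in> ?T d"
      using False B by (intro ex1I[of _ "\<Sum>B"]) simp_all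
    moreover have "\<forall>d\<in>?M. B \<notin> ?P d" using P_sum[of _ B] False by blast
    ultimately show ?thesis by blast
  qed
qed

section \<open>Lines through the origin over a prime field\<close>

locale vspace = fin_subgroup G for G :: "'v :: comm_ring_1 set" +
  fixes q :: nat
  assumes prime_q: "prime q" and char_q: "of_nat q = (0 :: 'v)"
begin

definition line :: "'v \<Rightarrow> 'v set" where "line u = range (\<lambda>c. of_int c * u)"

lemma line_self: "u \<in> line u"
  unfolding line_def by (rule range_eqI[of _ _ 1]) simp

lemma line_zero: "0 \<in> line u"
  unfolding line_def by (rule range_eqI[of _ _ 0]) simp

lemma line_diff: "x \<in> line u \<Longrightarrow> y \<in> line u \<Longrightarrow> x - y \<in> line u"
  unfolding line_def
proof (elim rangeE)
  fix c c' assume "x = of_int c * u" "y = of_int c' * u"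
  then have "x - y = of_int (c - c') * u" by (simp add: left_diff_distrib)
  then show "x - y \<in> range (\<lambda>c. of_int c * u)" by blast
qed

lemma line_minus: "x \<in> line u \<Longrightarrow> - x \<in> line u"
  using line_diff[OF line_zero] by simp

lemma line_minus_iff: "- x \<in> line u \<longleftrightarrow> x \<in> line u"
  using line_minus[of x] line_minus[of "- x"] by auto

lemma line_add: "x \<in> line u \<Longrightarrow> y \<in> line u \<Longrightarrow> x + y \<in> line u"
  using line_diff[of x u "- y"] line_minus by simp

lemma line_mult: "x \<in> line u \<Longrightarrow> of_int c * x \<in> line u"
  unfolding line_def
proof (elim rangeE)
  fix c' assume "x = of_int c' * u"
  then have "of_int c * x = of_int (c * c') * u" by (simp add: mult.assoc)
  then show "of_int c * x \<in> range (\<lambda>c. of_int c * u)" by blast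
qed

lemma char_int: "of_int (int q * c) = (0 :: 'v)"
  using char_q by simp

text \<open>Bezout modulo q. The ambient ring need not be a field, so division is restricted to
  integers prime to q.\<close>

lemma inverse:
  assumes "\<not> int q dvd c" obtains c' where "of_int c' * of_int c = (1 :: 'v)"
proof -
  have "coprime (int q) c" using assms prime_q by (simp add: prime_imp_coprime)
  then obtain a b where "a * int q + b * c = 1" using bezout_int[of "int q" c] by auto
  then have "of_int (int q * a + b * c) = (1 :: 'v)" by (simp add: mult.commute)
  then have "of_int b * of_int c = (1 :: 'v)"
    by (simp only: of_int_add char_int of_int_mult[of b]) simp
  then show ?thesis by (rule that)
qed

lemma line_subset: "x \<in> line u \<Longrightarrow> line x \<subseteq> line u"
  unfolding line_def[of x] using line_mult by blast

lemma line_eq: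
  assumes "x \<in> line u" "x \<noteq> 0" shows "line x = line u"
proof -
  obtain c where c: "x = of_int c * u" using assms by (auto simp: line_def)
  have "\<not> int q dvd c" using c assms(2) char_int by (auto elim!: dvdE)
  then obtain c' where "of_int c' * of_int c = (1 :: 'v)" by (rule inverse)
  then have "u = of_int c' * x" unfolding c by (simp flip: mult.assoc)
  then have "u \<in> line x" using line_mult line_self by metis
  then show ?thesis using line_subset assms(1) by blast
qed

lemma line_mult_cancel:
  assumes "of_int c * x \<in> line u" "\<not> int q dvd c" shows "x \<in> line u"
proof -
  obtain c' where "of_int c' * of_int c = (1 :: 'v)" using assms(2) by (rule inverse)
  then have "x = of_int c' * (of_int c * x)" by (simp flip: mult.assoc)
  then show ?thesis using line_mult[OF assms(1), of c'] by metis
qed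

lemma line_G: "u \<in> G \<Longrightarrow> line u \<subseteq> G"
  using of_int_mult_G by (auto simp: line_def)

lemma line_nat:
  assumes "x \<in> line u" obtains k where "k < q" "x = of_nat k * u"
proof -
  obtain c where c: "x = of_int c * u" using assms by (auto simp: line_def)
  have "(of_int c :: 'v) = of_int (int q * (c div int q) + c mod int q)" by simp
  also have "\<dots> = of_int (c mod int q)" by (simp only: of_int_add char_int) simp
  finally have "x = of_nat (nat (c mod int q)) * u"
    using c prime_gt_0_nat[OF prime_q] by (simp add: of_nat_nat)
  moreover have "nat (c mod int q) < q"
    using prime_gt_0_nat[OF prime_q] by (simp add: nat_less_iff)
  ultimately show ?thesis using that by blast
qed

lemma nat_in_line: "of_nat k * u \<in> line u"
  unfolding line_def by (rule range_eqI[of _ _ "int k"]) simp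

lemma nat_mult_inj:
  fixes u :: 'v
  assumes "of_nat a * u = of_nat b * u" "a < q" "b < q" "u \<noteq> 0" shows "a = b"
proof (rule ccontr)
  assume "a \<noteq> b"
  then have "\<not> int q dvd int a - int b"
    using assms(2,3) by (simp flip: mod_eq_dvd_iff)
  then obtain c' where c': "of_int c' * of_int (int a - int b) = (1 :: 'v)" by (rule inverse)
  have "of_int (int a - int b) * u = 0" using assms(1) by (simp add: algebra_simps)
  then have "1 * u = 0" unfolding c'[symmetric] by (simp only: mult.assoc mult_zero_right)
  then show False using assms(4) by simp
qed

text \<open>A base design need not be invariant under rescaling its residues, so two generators of a
  line may produce different copies of it. Fixing one generator per line leaves a single copy for
  each centre and line.\<close>

lemma ex_line_representatives:
  "\<exists>U. U \<subseteq> G - {0} \<and> (\<forall>x\<in>G - {0}. \<exists>!u. u \<in> U \<and> x \<in> line u)"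
proof -
  define f where "f L = (SOME u. u \<in> G - {0} \<and> line u = L)" for L
  have f: "f (line x) \<in> G - {0} \<and> line (f (line x)) = line x" if "x \<in> G - {0}" for x
    unfolding f_def by (rule someI[of _ x]) (use that in simp)
  show ?thesis
  proof (intro exI[of _ "(\<lambda>x. f (line x)) ` (G - {0})"] conjI ballI)
    fix x assume x: "x \<in> G - {0}"
    show "\<exists>!u. u \<in> (\<lambda>x. f (line x)) ` (G - {0}) \<and> x \<in> line u"
    proof (rule ex1I[of _ "f (line x)"])
      fix u assume u: "u \<in> (\<lambda>x. f (line x)) ` (G - {0}) \<and> x \<in> line u"
      then obtain y where y: "y \<in> G - {0}" "u = f (line y)" by blast
      then have "line u = line y" using f by simp
      moreover have "line x = line u" using line_eq u x by blast
      ultimately show "u = f (line x)" using y by simp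
    qed (use f x line_self in auto)
  qed (use f in auto)
qed

end

section \<open>Lifting a base design along the lines through the origin\<close>

text \<open>
  A base design lives on the points \<open>0, \<dots>, 2 * q\<close>: the code \<open>2 * c + a\<close> stands for the residue
  \<open>c\<close> modulo \<open>q\<close> on level \<open>a\<close>, and \<open>2 * q\<close> for the point at infinity. \<open>Fam None\<close> is a
  parallel class without its block \<open>core\<close>, and \<open>Fam (Some j)\<close> the remaining blocks
  of the \<open>j\<close>-th of two triple systems containing it.
\<close>

locale base_design =
  fixes q :: nat and Fam :: "bool option \<Rightarrow> nat set set"
begin

definition core :: "nat set" where "core = {0, 1, 2 * q}"
definition vert :: "nat \<Rightarrow> nat set" where "vert c = {2 * c, 2 * c + 1, 2 * q}"
definition trm :: "nat \<Rightarrow> nat \<Rightarrow> nat" where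
  "trm c k = (if k = 2 * q then k else (k + 2 * c) mod (2 * q))"

end

text \<open>Pairs inside \<open>core\<close> are left out because \<open>core\<close> becomes a
  block shared by all lines, and no other block may cover them. By \<open>base_triple\<close> a
  triple that is not vertical determines both its rotation and its family.\<close>

locale proper_base_design = base_design +
  assumes base_block: "b \<in> Fam l \<Longrightarrow> b \<subseteq> {..2 * q}"
    and base_card: "b \<in> Fam l \<Longrightarrow> card b = 3"
    and base_core: "b \<in> Fam l \<Longrightarrow> x \<in> b \<Longrightarrow> y \<in> b \<Longrightarrow> x \<in> core \<Longrightarrow> y \<in> core \<Longrightarrow> x = y"
    and base_avoid: "b \<in> Fam None \<Longrightarrow> b \<inter> core = {}"
    and base_parallel: "x \<le> 2 * q \<Longrightarrow> x \<notin> core \<Longrightarrow> \<exists>!b. b \<in> Fam None \<and> x \<in> b"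
    and base_pair: "x \<le> 2 * q \<Longrightarrow> y \<le> 2 * q \<Longrightarrow> x \<noteq> y \<Longrightarrow> \<not> (x \<in> core \<and> y \<in> core) \<Longrightarrow>
      \<exists>!b. b \<in> Fam None \<union> Fam (Some j) \<and> x \<in> b \<and> y \<in> b"
    and base_vert: "c < q \<Longrightarrow> vert c \<notin> Fam l"
    and base_triple: "b \<subseteq> {..2 * q} \<Longrightarrow> card b = 3 \<Longrightarrow> (\<And>c. c < q \<Longrightarrow> b \<noteq> vert c) \<Longrightarrow>
      \<exists>!t. fst t < q \<and> b \<in> (`) (trm (fst t)) ` Fam (snd t)"

locale lifting = vspace G q + proper_base_design q Fam
  for G :: "'v :: comm_ring_1 set" and q :: nat and Fam :: "bool option \<Rightarrow> nat set set" +
  fixes U :: "'v set"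
  assumes U_G: "U \<subseteq> G - {0}" and U_ex1: "x \<in> G - {0} \<Longrightarrow> \<exists>!u. u \<in> U \<and> x \<in> line u"
    and q_neq_3: "q \<noteq> 3" and G_nontrivial: "G \<noteq> {0}"
begin

definition X :: "('v \<times> bool) option set" where "X = insert None (Some ` (G \<times> UNIV))"

definition emb :: "'v \<Rightarrow> 'v \<Rightarrow> nat \<Rightarrow> ('v \<times> bool) option" where
  "emb g u k = (if k = 2 * q then None else Some (g + of_nat (k div 2) * u, odd k))"

text \<open>The translate by g of {infinity} Un (L x {0, 1}) with L = \<open>line u\<close>;
  \<open>emb g u\<close> identifies the base points with it, residue 0 going to g.\<close>

definition flat :: "'v \<Rightarrow> 'v \<Rightarrow> ('v \<times> bool) option set" where
  "flat g u = insert None {Some (x, a) |x a. x - g \<in> line u}"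

text \<open>The image of \<open>core\<close> under every \<open>emb g u\<close>; flats through g of
  different directions meet exactly here.\<close>

definition axis :: "'v \<Rightarrow> ('v \<times> bool) option set" where
  "axis g = {None, Some (g, False), Some (g, True)}"

definition lin :: "'v \<Rightarrow> bool option \<Rightarrow> ('v \<times> bool) option set set" where
  "lin g l = {emb g u ` b |u b. u \<in> U \<and> b \<in> Fam l}"

definition sg :: "bool \<Rightarrow> bool \<Rightarrow> 'v \<Rightarrow> 'v" where "sg j a x = (if a = j then x else - x)"

text \<open>The zero vector lies on every line, so for centre and points in G neither x nor y may
  equal g.\<close>

definition indep :: "'v \<Rightarrow> 'v \<Rightarrow> 'v \<Rightarrow> bool" where
  "indep g x y \<longleftrightarrow> \<not> (\<exists>u\<in>U. x - g \<in> line u \<and> y - g \<in> line u)"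

text \<open>
  Up to reflecting the level other than \<open>j\<close> in \<open>g\<close>, these are the triples with sum zero
  in \<open>G \<times> \<int>\<^sub>2\<close>.
\<close>

definition gen_rel :: "'v \<Rightarrow> bool \<Rightarrow> 'v \<times> bool \<Rightarrow> 'v \<times> bool \<Rightarrow> 'v \<times> bool \<Rightarrow> bool" where
  "gen_rel g j = (\<lambda>(x, a) (y, b) (z, c). x \<in> G \<and> y \<in> G \<and> z \<in> G \<and>
     indep g x y \<and> indep g x z \<and> indep g y z \<and> (a = b) = (c = j) \<and>
     sg j a (x - g) + sg j b (y - g) + sg j c (z - g) = 0)"

definition gen :: "'v \<Rightarrow> bool \<Rightarrow> ('v \<times> bool) option set set" where
  "gen g j = {{Some p, Some p', Some p''} |p p' p''. gen_rel g j p p' p''}"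

text \<open>The parallel class \<open>blk g None\<close> serves both indices (g, j), which accounts
  for its being listed twice; \<open>blk g (Some j)\<close> completes it to a triple system.\<close>

fun blk :: "'v \<Rightarrow> bool option \<Rightarrow> ('v \<times> bool) option set set" where
  "blk g None = insert (axis g) (lin g None)"
| "blk g (Some j) = lin g (Some j) \<union> gen g j"

section \<open>The triple systems with a fixed centre\<close>

lemma q_pos: "q > 0"
  using prime_q by (simp add: prime_gt_0_nat)

lemma U_nz: "u \<in> U \<Longrightarrow> u \<noteq> 0" "u \<in> U \<Longrightarrow> u \<in> G"
  using U_G by auto

lemma U_unique: "u \<in> U \<Longrightarrow> u' \<in> U \<Longrightarrow> x \<in> line u \<Longrightarrow> x \<in> line u' \<Longrightarrow> x \<noteq> 0 \<Longrightarrow> u = u'"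
  using U_ex1[of x] line_G[of u] U_nz(2)[of u] by blast

lemma U_obtain:
  assumes "x \<in> G" obtains u where "u \<in> U" "x \<in> line u"
proof (cases "x = 0")
  case True
  obtain y where "y \<in> G - {0}" using G_nontrivial zero_G by blast
  then obtain u where "u \<in> U" using U_ex1[of y] by blast
  then show ?thesis using that line_zero True by blast
next
  case False
  then show ?thesis using that U_ex1[of x] assms by blast
qed

lemma emb_inj:
  assumes "u \<in> U" shows "inj_on (emb g u) {..2 * q}"
proof (rule inj_onI)
  fix k k' assume k: "k \<in> {..2 * q}" "k' \<in> {..2 * q}" and eq: "emb g u k = emb g u k'"
  show "k = k'"
  proof (cases "k = 2 * q \<or> k' = 2 * q")
    case False
    then have "of_nat (k div 2) * u = of_nat (k' div 2) * u" and odd: "odd k = odd k'"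
      using eq by (auto simp: emb_def)
    then have "k div 2 = k' div 2"
      by (rule_tac nat_mult_inj) (use False k U_nz(1)[OF assms] in auto)
    then show ?thesis using odd by (metis odd_iff_mod_2_eq_one even_iff_mod_2_eq_zero div_mult_mod_eq)
  qed (use eq in \<open>auto simp: emb_def split: if_splits\<close>)
qed

lemma emb_flat: "emb g u k \<in> flat g u"
  by (auto simp: emb_def flat_def nat_in_line)

lemma flat_obtain:
  assumes "p \<in> flat g u" obtains k where "k \<le> 2 * q" "emb g u k = p"
proof (cases p)
  case None
  then show ?thesis using that[of "2 * q"] by (simp add: emb_def)
next
  case (Some xa)
  then obtain x a where p: "p = Some (x, a)" "x - g \<in> line u"
    using assms by (auto simp: flat_def)
  obtain c where c: "c < q" "x - g = of_nat c * u" using p(2) by (rule line_nat)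
  have "x = g + of_nat c * u" using c(2) by (simp add: algebra_simps)
  then show ?thesis using that[of "2 * c + of_bool a"] c(1) p(1) by (auto simp: emb_def)
qed

lemma lin_flat:
  assumes "B \<in> lin g l" obtains u b where "u \<in> U" "b \<in> Fam l" "B = emb g u ` b" "B \<subseteq> flat g u"
  using assms emb_flat unfolding lin_def by blast

lemma flat_shared:
  assumes "u \<in> U" "u' \<in> U" "p \<in> flat g u" "p \<in> flat g u'" "p \<notin> axis g"
  shows "u = u'"
proof -
  obtain x a where "p = Some (x, a)" using assms(5) by (cases p) (auto simp: axis_def)
  then show ?thesis using assms U_unique[of u u' "x - g"] by (auto simp: flat_def axis_def)
qed

lemma emb_axis:
  assumes "u \<in> U" "k \<le> 2 * q" shows "emb g u k \<in> axis g \<longleftrightarrow> k \<in> core"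
proof -
  have "axis g = emb g u ` core"
    using q_pos by (auto simp: axis_def core_def emb_def)
  moreover have "core \<subseteq> {..2 * q}" using q_pos by (auto simp: core_def)
  ultimately show ?thesis using inj_on_image_mem_iff[OF emb_inj[OF assms(1)], of k core g] assms by auto
qed

lemma flat_X: "g \<in> G \<Longrightarrow> u \<in> U \<Longrightarrow> flat g u \<subseteq> X"
proof
  fix p assume "g \<in> G" "u \<in> U" "p \<in> flat g u"
  then have "x \<in> G" if "p = Some (x, a)" for x a
    using that line_G[OF U_nz(2)] add_G[of "x - g" g] by (auto simp: flat_def)
  then show "p \<in> X" by (cases p) (auto simp: X_def)
qed

lemma off_axis:
  assumes "p \<in> X" "p \<notin> axis g" obtains x a where "p = Some (x, a)" "x \<in> G" "x \<noteq> g"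
  using assms by (cases p) (auto simp: X_def axis_def)

lemma card_lin: "B \<in> lin g l \<Longrightarrow> card B = 3"
  by (erule lin_flat) (simp add: card_image[OF inj_on_subset[OF emb_inj base_block]] base_card)

lemma indep_neq: "indep g x y \<Longrightarrow> x \<in> G \<Longrightarrow> g \<in> G \<Longrightarrow> x \<noteq> y"
  unfolding indep_def using U_obtain[of "x - g"] diff_G by metis

lemma gen_rel_swap:
  "gen_rel g j p p' p'' \<Longrightarrow> gen_rel g j p' p p''" "gen_rel g j p p' p'' \<Longrightarrow> gen_rel g j p p'' p'"
  unfolding gen_rel_def indep_def by (auto simp: algebra_simps split: prod.splits)

lemma gen_obtain:
  assumes "B \<in> gen g j" "Some p \<in> B" "Some p' \<in> B" "p \<noteq> p'"
  obtains p'' where "B = {Some p, Some p', Some p''}" "gen_rel g j p p' p''"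
proof -
  obtain r s t where B: "B = {Some r, Some s, Some t}" and rel: "gen_rel g j r s t"
    using assms(1) unfolding gen_def by blast
  have "p = r \<and> p' = s \<or> p = r \<and> p' = t \<or> p = s \<and> p' = r \<or> p = s \<and> p' = t \<or>
      p = t \<and> p' = r \<or> p = t \<and> p' = s"
    using assms(2-4) B by auto
  then show ?thesis using that rel gen_rel_swap B
    by (elim disjE) (metis insert_commute)+
qed

lemma gen_indep:
  assumes "B \<in> gen g j" "Some (x, a) \<in> B" "Some (y, b) \<in> B" "(x, a) \<noteq> (y, b)"
  shows "indep g x y"
  by (rule gen_obtain[OF assms]) (auto simp: gen_rel_def)

lemma gen_None: "B \<in> gen g j \<Longrightarrow> None \<notin> B"
  by (auto simp: gen_def)

lemma gen_X: "B \<in> gen g j \<Longrightarrow> B \<subseteq> X"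
  by (auto simp: gen_def gen_rel_def X_def)

lemma card_gen: "B \<in> gen g j \<Longrightarrow> g \<in> G \<Longrightarrow> card B = 3"
  unfolding gen_def gen_rel_def using indep_neq by fastforce

lemma sg_sg: "sg j a (sg j a x) = x" "sg j a x = y \<longleftrightarrow> x = sg j a y" "sg j a x \<in> line u \<longleftrightarrow> x \<in> line u"
  by (auto simp: sg_def line_minus_iff)

lemma sg_closed: "x \<in> G \<Longrightarrow> sg j a x \<in> G"
  using minus_G by (simp add: sg_def)

lemma gen_rel_third:
  assumes "gen_rel g j (x, a) (y, b) (z, c)"
  shows "c = (j = (a = b))" "z = g - sg j c (sg j a (x - g) + sg j b (y - g))"
proof -
  show "c = (j = (a = b))" using assms by (auto simp: gen_rel_def)
  have "sg j a (x - g) + sg j b (y - g) + sg j c (z - g) = 0"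
    using assms by (simp add: gen_rel_def)
  then have "sg j c (z - g) = - (sg j a (x - g) + sg j b (y - g))"
    unfolding eq_neg_iff_add_eq_0 by (subst add.commute)
  then have "z - g = sg j c (- (sg j a (x - g) + sg j b (y - g)))" by (simp add: sg_sg)
  also have "\<dots> = - sg j c (sg j a (x - g) + sg j b (y - g))" by (simp add: sg_def)
  finally show "z = g - sg j c (sg j a (x - g) + sg j b (y - g))" by (simp add: algebra_simps)
qed

text \<open>Up to sign z - g is a signed sum of x - g and y - g, so a line containing it and one of
  them would contain the other, against their independence.\<close>

lemma gen_rel_exists:
  assumes g: "g \<in> G" and xy: "x \<in> G" "y \<in> G" and ind: "indep g x y"
  obtains p where "gen_rel g j (x, a) (y, b) p"
proof -
  define c where "c = (j = (a = b))"
  define z where "z = g - sg j c (sg j a (x - g) + sg j b (y - g))"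
  have z: "sg j c (z - g) = - (sg j a (x - g) + sg j b (y - g))"
    unfolding z_def by (simp add: sg_def)
  have "z \<in> G" unfolding z_def using g xy diff_G add_G sg_closed by simp
  moreover have "indep g x z"
  proof -
    have "y - g \<in> line u" if "x - g \<in> line u" "z - g \<in> line u" for u
    proof -
      have "sg j b (y - g) = - (sg j c (z - g)) - sg j a (x - g)" using z by simp
      moreover have "\<dots> \<in> line u" using that by (intro line_diff line_minus) (simp_all add: sg_sg)
      ultimately show ?thesis by (metis sg_sg(3))
    qed
    then show ?thesis using ind by (auto simp: indep_def)
  qed
  moreover have "indep g y z"
  proof -
    have "x - g \<in> line u" if "y - g \<in> line u" "z - g \<in> line u" for u
    proof -
      have "sg j a (x - g) = - (sg j c (z - g)) - sg j b (y - g)" using z by simp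
      moreover have "\<dots> \<in> line u" using that by (intro line_diff line_minus) (simp_all add: sg_sg)
      ultimately show ?thesis by (metis sg_sg(3))
    qed
    then show ?thesis using ind by (auto simp: indep_def)
  qed
  ultimately have "gen_rel g j (x, a) (y, b) (z, c)"
    using xy ind z by (auto simp: gen_rel_def c_def)
  then show ?thesis by (rule that)
qed

lemma blk_sub:
  assumes "g \<in> G" "B \<in> blk g l" shows "B \<subseteq> X \<and> card B = 3"
proof -
  have lin: "B \<subseteq> X \<and> card B = 3" if "B \<in> lin g l'" for l'
    using lin_flat[OF that] card_lin[OF that] flat_X[OF assms(1)] by (metis order_trans)
  have "axis g \<subseteq> X" "card (axis g) = 3" using assms(1) by (auto simp: axis_def X_def)
  moreover have "B \<subseteq> X \<and> card B = 3" if "B \<in> gen g j" for j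
    using gen_X[OF that] card_gen[OF that assms(1)] by blast
  ultimately show ?thesis using assms(2) lin by (cases l) (auto simp del: insert_iff)
qed

text \<open>The class of the base design avoids \<open>core\<close>, so the points of the axis are
  covered by the axis alone. Any other point lies in one flat through g, where the base class covers
  it once.\<close>

lemma blk_parallel:
  assumes g: "g \<in> G" and p: "p \<in> X"
  shows "\<exists>!B. B \<in> blk g None \<and> p \<in> B"
proof (cases "p \<in> axis g")
  case True
  have "p \<notin> B" if B: "B \<in> lin g None" for B
  proof
    assume "p \<in> B"
    obtain u b where u: "u \<in> U" "b \<in> Fam None" "B = emb g u ` b" using B by (rule lin_flat)
    then obtain k where k: "k \<in> b" "p = emb g u k" using \<open>p \<in> B\<close> by blast
    then have "k \<in> core" using emb_axis[OF u(1), of k g] base_block[OF u(2)] True by auto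
    then show False using base_avoid[OF u(2)] k by blast
  qed
  then show ?thesis using True by (intro ex1I[of _ "axis g"]) auto
next
  case False
  then obtain x a where x: "p = Some (x, a)" "x \<in> G" "x \<noteq> g" using p by (rule_tac off_axis)
  obtain u where u: "u \<in> U" "x - g \<in> line u" using U_obtain diff_G x g by metis
  have pu: "p \<in> flat g u" using u x by (simp add: flat_def)
  then obtain k where k: "k \<le> 2 * q" "emb g u k = p" by (rule flat_obtain)
  have "k \<notin> core" using emb_axis[OF u(1) k(1), of g] k False by simp
  from base_parallel[OF k(1) this] obtain b where b: "b \<in> Fam None \<and> k \<in> b"
    and b_uniq: "\<forall>b'. b' \<in> Fam None \<and> k \<in> b' \<longrightarrow> b' = b"
    by (rule ex1E)
  show ?thesis
  proof (rule ex1I[of _ "emb g u ` b"])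
    show "emb g u ` b \<in> blk g None \<and> p \<in> emb g u ` b" using u b k by (auto simp: lin_def)
  next
    fix B assume B: "B \<in> blk g None \<and> p \<in> B"
    then have "B \<in> lin g None" using False by auto
    then obtain u' b' where u': "u' \<in> U" "b' \<in> Fam None" "B = emb g u' ` b'" "B \<subseteq> flat g u'"
      by (rule lin_flat)
    then have "p \<in> flat g u'" using B by blast
    then have "u' = u" by (rule flat_shared[OF u'(1) u(1) _ pu False])
    moreover from this have "k \<in> b'"
      using u'(3) B k inj_on_image_mem_iff[OF emb_inj[OF u(1)], of k b' g] base_block[OF u'(2)] by simp
    then have "b' = b" using b_uniq u'(2) by simp
    ultimately show "B = emb g u ` b" using u'(3) by simp
  qed
qed

text \<open>The point p singles out one flat through g. If p' lies in it, the base design covers the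
  pair; if not, p and p' are independent over g and the sum rule fixes the level and the place of
  the third point.\<close>

lemma blk_pair_off_axis:
  assumes g: "g \<in> G" and p: "p \<in> X" "p' \<in> X" "p \<noteq> p'" "p \<notin> axis g"
  shows "\<exists>!B. B \<in> blk g None \<union> blk g (Some j) \<and> p \<in> B \<and> p' \<in> B"
proof -
  obtain x a where x: "p = Some (x, a)" "x \<in> G" "x \<noteq> g" using p(1,4) by (rule off_axis)
  obtain u where u: "u \<in> U" "x - g \<in> line u" using U_obtain diff_G x g by metis
  have pu: "p \<in> flat g u" using u x by (simp add: flat_def)
  have lin_obtain: "\<exists>b. b \<in> Fam None \<union> Fam (Some j) \<and> B = emb g u ` b \<and> p' \<in> flat g u"
    if B: "B \<in> lin g None \<union> lin g (Some j)" "p \<in> B" "p' \<in> B" for B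
  proof -
    obtain l where l: "l = None \<or> l = Some j" "B \<in> lin g l" using B by blast
    obtain u' b where u': "u' \<in> U" "b \<in> Fam l" "B = emb g u' ` b" "B \<subseteq> flat g u'"
      using l(2) by (rule lin_flat)
    then have "p \<in> flat g u'" using B by blast
    then have "u' = u" by (rule flat_shared[OF u'(1) u(1) _ pu p(4)])
    then have "B = emb g u ` b" "p' \<in> flat g u" using u' B by blast+
    then show ?thesis using u'(2) l(1) by blast
  qed
  show ?thesis
  proof (cases "p' \<in> flat g u")
    case True
    obtain k where k: "k \<le> 2 * q" "emb g u k = p" using pu by (rule flat_obtain)
    obtain k' where k': "k' \<le> 2 * q" "emb g u k' = p'" using True by (rule flat_obtain)
    have "k \<notin> core" using emb_axis[OF u(1) k(1), of g] k p by simp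
    moreover have "k \<noteq> k'" using k k' p by blast
    ultimately have "\<exists>!b. b \<in> Fam None \<union> Fam (Some j) \<and> k \<in> b \<and> k' \<in> b"
      using base_pair[OF k(1) k'(1)] by simp
    then obtain b where b: "b \<in> Fam None \<union> Fam (Some j) \<and> k \<in> b \<and> k' \<in> b"
      and b_uniq: "\<forall>b'. b' \<in> Fam None \<union> Fam (Some j) \<and> k \<in> b' \<and> k' \<in> b' \<longrightarrow> b' = b"
      by (rule ex1E)
    show ?thesis
    proof (rule ex1I[of _ "emb g u ` b"])
      show "emb g u ` b \<in> blk g None \<union> blk g (Some j) \<and> p \<in> emb g u ` b \<and> p' \<in> emb g u ` b"
        using u b k k' by (auto simp: lin_def)
    next
      fix B assume B: "B \<in> blk g None \<union> blk g (Some j) \<and> p \<in> B \<and> p' \<in> B"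
      have "B \<notin> gen g j"
      proof
        assume G: "B \<in> gen g j"
        then have "p' \<noteq> None" using gen_None[OF G] B by metis
        then obtain y b where y: "p' = Some (y, b)" by (metis not_None_eq surj_pair)
        then have "indep g x y" using gen_indep[OF G, of x a y b] B x(1) p(3) by simp
        then show False using u True y by (auto simp: indep_def flat_def)
      qed
      then have "B \<in> lin g None \<union> lin g (Some j)" using B p(4) by auto
      then obtain b' where b': "b' \<in> Fam None \<union> Fam (Some j)" "B = emb g u ` b'"
        using lin_obtain[of B] B by blast
      have "b' \<subseteq> {..2 * q}" using b'(1) base_block by blast
      then have "k \<in> b'" "k' \<in> b'"
        using B b' k k' inj_on_image_mem_iff[OF emb_inj[OF u(1)], of _ b' g] by auto
      then show "B = emb g u ` b" using b_uniq b' by blast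
    qed
  next
    case False
    then obtain y b where y: "p' = Some (y, b)" "y \<in> G" using p by (auto simp: flat_def X_def)
    have "indep g x y"
    proof -
      have "u' = u" if "u' \<in> U" "x - g \<in> line u'" for u'
        using U_unique[OF that(1) u(1) that(2) u(2)] x by simp
      then show ?thesis using False y unfolding indep_def by (auto simp: flat_def)
    qed
    then obtain t where t: "gen_rel g j (x, a) (y, b) t" using gen_rel_exists g x y by metis
    show ?thesis
    proof (rule ex1I[of _ "{Some (x, a), Some (y, b), Some t}"])
      have "{Some (x, a), Some (y, b), Some t} \<in> gen g j" using t unfolding gen_def by blast
      then show "{Some (x, a), Some (y, b), Some t} \<in> blk g None \<union> blk g (Some j) \<and>
          p \<in> {Some (x, a), Some (y, b), Some t} \<and> p' \<in> {Some (x, a), Some (y, b), Some t}"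
        using x y by simp
    next
      fix B assume B: "B \<in> blk g None \<union> blk g (Some j) \<and> p \<in> B \<and> p' \<in> B"
      then have "B \<notin> lin g None \<union> lin g (Some j)" using lin_obtain[of B] False by blast
      then have "B \<in> gen g j" using B p(4) by auto
      from gen_obtain[OF this, of "(x, a)" "(y, b)"] obtain t'
        where t': "B = {Some (x, a), Some (y, b), Some t'}" "gen_rel g j (x, a) (y, b) t'"
        using B x(1) y(1) p(3) by auto
      obtain z c z' c' where zz: "t = (z, c)" "t' = (z', c')" by fastforce
      then have "t = t'"
        using gen_rel_third[of g j x a y b z c] gen_rel_third[of g j x a y b z' c'] t t' by simp
      then show "B = {Some (x, a), Some (y, b), Some t}" using t' by simp
    qed
  qed
qed

lemma lin_axis:
  assumes "B \<in> lin g l" "p \<in> B" "p' \<in> B" "p \<in> axis g" "p' \<in> axis g" shows "p = p'"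
proof -
  obtain u b where u: "u \<in> U" "b \<in> Fam l" "B = emb g u ` b" using assms(1) by (rule lin_flat)
  then obtain k k' where k: "k \<in> b" "k' \<in> b" "p = emb g u k" "p' = emb g u k'" using assms by blast
  then have "k \<in> core" "k' \<in> core"
    using emb_axis[OF u(1), of _ g] base_block[OF u(2)] assms by auto
  then show ?thesis using base_core[OF u(2)] k by metis
qed

text \<open>A finite point of the axis differs from g by 0, which is dependent on
  everything.\<close>

lemma gen_axis: "B \<in> gen g j \<Longrightarrow> g \<in> G \<Longrightarrow> p \<in> B \<Longrightarrow> p \<notin> axis g"
proof
  assume B: "B \<in> gen g j" "g \<in> G" "p \<in> B" "p \<in> axis g"
  have "card (B - {p}) = 2" using B card_gen[of B g j] by (simp add: card_Diff_subset)
  then obtain p' where p': "p' \<in> B" "p' \<noteq> p" by (metis DiffE card_2_iff insertCI)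
  obtain x a y b where xy: "p = Some (x, a)" "p' = Some (y, b)"
    using gen_None[OF B(1)] B(3) p'(1) by (metis not_None_eq surj_pair)
  have "x = g" using B(4) xy by (auto simp: axis_def)
  moreover have "y \<in> G" using gen_X[OF B(1)] p'(1) xy by (auto simp: X_def)
  moreover have "indep g x y" using gen_indep[OF B(1)] B(3) p' xy by blast
  moreover obtain u where "u \<in> U" "y - g \<in> line u" using U_obtain diff_G B(2) \<open>y \<in> G\<close> by metis
  ultimately show False using line_zero by (auto simp: indep_def)
qed

lemma blk_pair:
  assumes g: "g \<in> G" and p: "p \<in> X" "p' \<in> X" "p \<noteq> p'"
  shows "\<exists>!B. B \<in> blk g None \<union> blk g (Some j) \<and> p \<in> B \<and> p' \<in> B"
proof (cases "p \<in> axis g")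
  case False
  then show ?thesis using blk_pair_off_axis assms by blast
next
  case True
  show ?thesis
  proof (cases "p' \<in> axis g")
    case False
    have "\<exists>!B. B \<in> blk g None \<union> blk g (Some j) \<and> p' \<in> B \<and> p \<in> B"
      by (rule blk_pair_off_axis) (use assms False in auto)
    then show ?thesis by (simp only: conj_commute)
  next
    case p': True
    show ?thesis
    proof (rule ex1I[of _ "axis g"])
      fix B assume B: "B \<in> blk g None \<union> blk g (Some j) \<and> p \<in> B \<and> p' \<in> B"
      have "B \<notin> lin g l" for l using lin_axis[of B g l p p'] B True p' p by blast
      moreover have "B \<notin> gen g j" using gen_axis[of B g j p] g B True by blast
      ultimately show "B = axis g" using B by auto
    qed (use True p' in auto)
  qed
qed

section \<open>Locating each triple in exactly one system\<close>

lemma emb_vert: "c < q \<Longrightarrow> emb g u ` vert c = axis (g + of_nat c * u)"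
  by (auto simp: vert_def axis_def emb_def)

lemma vert_sub: "c < q \<Longrightarrow> vert c \<subseteq> {..2 * q}"
  by (auto simp: vert_def)

text \<open>Such an axis would come from a vertical triple of the base design.\<close>

lemma axis_lin: "axis x \<notin> lin g l"
proof
  assume "axis x \<in> lin g l"
  then obtain u b where u: "u \<in> U" "b \<in> Fam l" "axis x = emb g u ` b" "axis x \<subseteq> flat g u"
    by (rule lin_flat)
  then have "x - g \<in> line u" by (auto simp: axis_def flat_def)
  then obtain c where c: "c < q" "x - g = of_nat c * u" by (rule line_nat)
  then have "x = g + of_nat c * u" by (simp add: algebra_simps)
  then have "emb g u ` b = emb g u ` vert c" using u(3) emb_vert[OF c(1)] by simp
  then have "b = vert c"
    using inj_on_image_eq_iff[OF emb_inj[OF u(1)] base_block[OF u(2)] vert_sub[OF c(1)]] by simp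
  then show False using base_vert[OF c(1)] u(2) by simp
qed

lemma axis_eq_iff: "axis x = axis g \<longleftrightarrow> x = g"
  by (auto simp: axis_def)

lemma axis_gen: "axis x \<notin> gen g j"
  using gen_None[of "axis x" g j] by (auto simp: axis_def)

lemma axis_blk: "axis x \<in> blk g l \<longleftrightarrow> x = g \<and> l = None"
  by (cases l) (simp_all add: axis_lin axis_gen axis_eq_iff)

text \<open>The link between the two developments: rotating the base design by c has the same effect
  as moving the centre from g to g + c u.\<close>

lemma emb_trm:
  assumes "k \<le> 2 * q" shows "emb g u (trm c k) = emb (g + of_nat c * u) u k"
proof (cases "k = 2 * q")
  case False
  define k' where "k' = (k + 2 * c) mod (2 * q)"
  have k': "k' < 2 * q" using q_pos by (simp add: k'_def)
  have odd: "odd k' = odd k" unfolding k'_def by (simp add: dvd_mod_iff)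
  have "k' div 2 = ((k + 2 * c) div 2) mod q"
    unfolding k'_def mod_mult2_eq by simp
  then have "k' div 2 = (k div 2 + c) mod q" by (simp add: add.commute)
  then have "(of_nat (k' div 2) :: 'v) = of_nat ((k div 2 + c) mod q)" by simp
  also have "\<dots> = of_nat (q * ((k div 2 + c) div q) + (k div 2 + c) mod q)"
    by (simp only: of_nat_add of_nat_mult char_q) simp
  also have "\<dots> = of_nat (k div 2) + of_nat c" by simp
  finally have "(of_nat (k' div 2) :: 'v) = of_nat (k div 2) + of_nat c" .
  then show ?thesis
    using False k' odd by (simp add: emb_def trm_def flip: k'_def) (simp add: algebra_simps)
qed (simp add: emb_def trm_def)

lemma trm_le: "k \<le> 2 * q \<Longrightarrow> trm c k \<le> 2 * q"
  using q_pos by (simp add: trm_def less_imp_le)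

lemma trm_Fam:
  assumes "b \<in> Fam l" shows "trm c ` b \<subseteq> {..2 * q}"
proof (rule image_subsetI)
  fix k assume "k \<in> b"
  then show "trm c k \<in> {..2 * q}" using base_block[OF assms] trm_le[of k c] by auto
qed

lemma emb_trm_image:
  assumes "b \<in> Fam l" shows "emb g u ` trm c ` b = emb (g + of_nat c * u) u ` b"
  using base_block[OF assms] emb_trm by (force simp: image_image intro!: image_cong)

lemma q_ndvd_3: "\<not> int q dvd 3"
proof
  assume "int q dvd 3"
  then have "q dvd 3" by (metis int_dvd_int_iff of_nat_numeral)
  moreover have "prime (3 :: nat)" by simp
  ultimately show False using prime_q q_neq_3 primes_dvd_imp_eq by blast
qed

text \<open>The flat need not pass through g. Differences of points in it are multiples of u. With
  three equal levels the sum rule makes 3 (x - g) such a multiple, and 3 can be cancelled; otherwise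
  two of the vectors x - g, y - g, z - g are themselves differences of points of the block. In each
  case two points are dependent over g.\<close>

lemma gen_not_flat:
  assumes B: "B \<in> gen g j" "B \<subseteq> flat m u" "u \<in> U" shows False
proof -
  obtain x a y b z c where eq: "B = {Some (x, a), Some (y, b), Some (z, c)}"
    and rel: "gen_rel g j (x, a) (y, b) (z, c)"
    using B(1) unfolding gen_def by fastforce
  have m: "x - m \<in> line u" "y - m \<in> line u" "z - m \<in> line u"
    using B(2) eq by (auto simp: flat_def)
  have d: "x - y \<in> line u" "x - z \<in> line u" "y - z \<in> line u"
    "y - x \<in> line u" "z - x \<in> line u" "z - y \<in> line u"
    using line_diff[OF m(1) m(2)] line_diff[OF m(1) m(3)] line_diff[OF m(2) m(3)]
      line_diff[OF m(2) m(1)] line_diff[OF m(3) m(1)] line_diff[OF m(3) m(2)] by simp_all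
  have ind: "\<not> (x - g \<in> line u \<and> y - g \<in> line u)" "\<not> (x - g \<in> line u \<and> z - g \<in> line u)"
    "\<not> (y - g \<in> line u \<and> z - g \<in> line u)"
    using rel B(3) by (auto simp: gen_rel_def indep_def)
  have lev: "(a = b) = (c = j)" and sum: "sg j a (x - g) + sg j b (y - g) + sg j c (z - g) = 0"
    using rel by (auto simp: gen_rel_def)
  consider "a = j" "b = j" "c = j" | "a = j" "b \<noteq> j" "c \<noteq> j" | "a \<noteq> j" "b = j" "c \<noteq> j"
    | "a \<noteq> j" "b \<noteq> j" "c = j" using lev by blast
  then show False
  proof cases
    case 1
    then have "of_int 3 * (x - g) = (x - y) + (x - z)"
      using sum by (simp add: sg_def algebra_simps)
    then have "of_int 3 * (x - g) \<in> line u" using line_add[OF d(1,2)] by metis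
    then have "x - g \<in> line u" using q_ndvd_3 by (rule line_mult_cancel)
    moreover from this have "y - g \<in> line u" using line_add[OF d(4), of "x - g"] by simp
    ultimately show False using ind by blast
  next
    case 2
    then have "y - g = x - z" "z - g = x - y" using sum by (simp_all add: sg_def algebra_simps)
    then show False using ind d by simp
  next
    case 3
    then have "x - g = y - z" "z - g = y - x" using sum by (simp_all add: sg_def algebra_simps)
    then show False using ind d by simp
  next
    case 4
    then have "x - g = z - y" "y - g = z - x" using sum by (simp_all add: sg_def algebra_simps)
    then show False using ind d by simp
  qed
qed

text \<open>The coefficient of g in the signed sum is minus the sum of the three signs, which is 3
  or -1. Hence k is the inverse of 3, or -1.\<close>

lemma centre:
  assumes "(a = b) = (c = j)"
  obtains k where
    "\<And>g. sg j a (x - g) + sg j b (y - g) + sg j c (z - g) = 0 \<longleftrightarrow>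
      g = of_int k * (sg j a x + sg j b y + sg j c z)"
proof (cases "a = j \<and> b = j")
  case True
  then have all: "a = j" "b = j" "c = j" using assms by auto
  obtain k where k: "of_int k * of_int 3 = (1 :: 'v)" using q_ndvd_3 by (rule inverse)
  have "sg j a (x - g) + sg j b (y - g) + sg j c (z - g) = 0 \<longleftrightarrow>
      g = of_int k * (sg j a x + sg j b y + sg j c z)" for g
  proof -
    have "sg j a (x - g) + sg j b (y - g) + sg j c (z - g) = 0 \<longleftrightarrow> x + y + z = of_int 3 * g"
      by (simp add: all sg_def algebra_simps)
    also have "\<dots> \<longleftrightarrow> g = of_int k * (x + y + z)"
    proof
      assume "x + y + z = of_int 3 * g"
      then have "of_int k * (x + y + z) = (of_int k * of_int 3) * g" by (simp only: mult.assoc)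
      then show "g = of_int k * (x + y + z)" unfolding k by simp
    next
      assume g: "g = of_int k * (x + y + z)"
      have "of_int 3 * g = (of_int k * of_int 3) * (x + y + z)" unfolding g by (simp only: mult_ac)
      then show "x + y + z = of_int 3 * g" unfolding k by simp
    qed
    finally show ?thesis by (simp add: all sg_def)
  qed
  then show ?thesis by (rule that)
next
  case False
  then have "sg j a (x - g) + sg j b (y - g) + sg j c (z - g) = 0 \<longleftrightarrow>
      g = of_int (- 1) * (sg j a x + sg j b y + sg j c z)" for g
    using assms by (auto simp: sg_def algebra_simps eq_neg_iff_add_eq_0)
  then show ?thesis by (rule that)
qed

text \<open>Since the point at infinity lies in all flats, every triple through it is contained in a
  flat.\<close>

lemma pair_flat:
  assumes "p \<in> X" "p' \<in> X" obtains m u where "m \<in> G" "u \<in> U" "p \<in> flat m u" "p' \<in> flat m u"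
proof -
  obtain u\<^sub>0 where u\<^sub>0: "u\<^sub>0 \<in> U" using U_obtain[OF zero_G] by blast
  show thesis
  proof (cases p)
    case None
    show thesis
    proof (cases p')
      case None': None
      show thesis using that[OF zero_G u\<^sub>0] None None' by (simp add: flat_def)
    next
      case (Some ya)
      then obtain y b where "p' = Some (y, b)" "y \<in> G" using assms by (auto simp: X_def)
      then show thesis using that[of y u\<^sub>0] u\<^sub>0 None by (simp add: flat_def line_zero)
    qed
  next
    case (Some xa)
    then obtain x a where x: "p = Some (x, a)" "x \<in> G" using assms by (auto simp: X_def)
    show thesis
    proof (cases p')
      case None
      then show thesis using that[of x u\<^sub>0] u\<^sub>0 x by (simp add: flat_def line_zero)
    next
      case (Some ya)
      then obtain y b where y: "p' = Some (y, b)" "y \<in> G" using assms by (auto simp: X_def)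
      obtain u where "u \<in> U" "y - x \<in> line u" using U_obtain diff_G[OF y(2) x(2)] by blast
      then show thesis using that[of x u] x y by (simp add: flat_def line_zero)
    qed
  qed
qed

lemma line_sum_zero: "x + y + z = 0 \<Longrightarrow> x \<in> line u \<Longrightarrow> y \<in> line u \<Longrightarrow> z \<in> line u"
  using line_minus[OF line_add, of x u y] by (simp add: add_eq_0_iff)

text \<open>Two different G-coordinates are what is needed to read off the direction of a flat
  containing B.\<close>

lemma distinct_places:
  assumes B: "B \<subseteq> X" "card B = 3" "\<And>x. x \<in> G \<Longrightarrow> B \<noteq> axis x"
  obtains x a y b where "Some (x, a) \<in> B" "Some (y, b) \<in> B" "x \<noteq> y"
proof (rule ccontr)
  assume "\<not> thesis"
  then have same: "x = y" if "Some (x, a) \<in> B" "Some (y, b) \<in> B" for x a y b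
    using \<open>\<And>y x b a. Some (x, a) \<in> B \<Longrightarrow> Some (y, b) \<in> B \<Longrightarrow> x \<noteq> y \<Longrightarrow> thesis\<close> that by blast
  have "\<not> B \<subseteq> {None}" using B(2) card_mono[of "{None}" B] by auto
  then obtain x a where x: "Some (x, a) \<in> B" by (metis insertI1 not_None_eq subsetI surj_pair)
  have "r \<in> axis x" if r: "r \<in> B" for r
  proof (cases r)
    case (Some yb)
    then obtain y b where "r = Some (y, b)" by fastforce
    then show ?thesis using same[of y b x a] r x by (cases b) (auto simp: axis_def)
  qed (simp add: axis_def)
  then have "B \<subseteq> axis x" by blast
  then have "B = axis x" using B(2) by (intro card_subset_eq) (auto simp: axis_def)
  moreover have "x \<in> G" using x B(1) by (auto simp: X_def)
  ultimately show False using B(3) by blast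
qed

text \<open>An axis gives its own centre. A triple in a flat cannot obey a sum rule; its direction
  is determined, and \<open>base_triple\<close> yields the rotation, hence the centre, and the
  family. For any other triple the levels determine j and the sum rule determines the
  centre.\<close>

lemma ex1_blk:
  assumes B: "B \<subseteq> X" "card B = 3"
  shows "\<exists>!t. fst t \<in> G \<and> B \<in> blk (fst t) (snd t)"
proof (cases "\<exists>x\<in>G. B = axis x")
  case True
  then obtain x where "x \<in> G" "B = axis x" by blast
  then show ?thesis by (intro ex1I[of _ "(x, None)"]) (auto simp: axis_blk)
next
  case no_axis: False
  have Bl: "B \<in> blk g l \<longleftrightarrow> B \<in> lin g l \<or> (\<exists>j. l = Some j \<and> B \<in> gen g j)" if "g \<in> G" for g l
    using no_axis that by (cases l) auto
  show ?thesis
  proof (cases "\<exists>m\<in>G. \<exists>u\<in>U. B \<subseteq> flat m u")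
    case True
    then obtain m u where m: "m \<in> G" "u \<in> U" "B \<subseteq> flat m u" by blast
    define b where "b = {k\<in>{..2 * q}. emb m u k \<in> B}"
    have b: "b \<subseteq> {..2 * q}" by (auto simp: b_def)
    have Bb: "B = emb m u ` b"
    proof
      show "B \<subseteq> emb m u ` b"
      proof
        fix p assume p: "p \<in> B"
        then obtain k where "k \<le> 2 * q" "emb m u k = p" using m(3) flat_obtain by blast
        then show "p \<in> emb m u ` b" using p by (auto simp: b_def)
      qed
    qed (auto simp: b_def)
    have card_b: "card b = 3"
      using B(2) card_image[OF inj_on_subset[OF emb_inj[OF m(2)] b], of m] Bb by simp
    have "b \<noteq> vert c" if c: "c < q" for c
    proof
      assume "b = vert c"
      then have "B = axis (m + of_nat c * u)" using Bb emb_vert[OF c] by simp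
      moreover have "m + of_nat c * u \<in> G"
        using add_G[OF m(1)] of_int_mult_G[OF U_nz(2)[OF m(2)], of "int c"] by simp
      ultimately show False using no_axis by blast
    qed
    from base_triple[OF b card_b this] obtain t where
      t: "fst t < q \<and> b \<in> (`) (trm (fst t)) ` Fam (snd t)" and
      t_uniq: "\<forall>t'. fst t' < q \<and> b \<in> (`) (trm (fst t')) ` Fam (snd t') \<longrightarrow> t' = t"
      by (rule ex1E)
    obtain c l where cl: "t = (c, l)" by fastforce
    obtain b' where b': "b' \<in> Fam l" "b = trm c ` b'" using t cl by auto
    define g where "g = m + of_nat c * u"
    have "B = emb g u ` b'" using Bb b' emb_trm_image[OF b'(1)] by (simp add: g_def)
    then have in_lin: "B \<in> lin g l" using b'(1) m(2) unfolding lin_def by blast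
    have g: "g \<in> G"
      using add_G[OF m(1)] of_int_mult_G[OF U_nz(2)[OF m(2)], of "int c"] by (simp add: g_def)
    show ?thesis
    proof (rule ex1I[of _ "(g, l)"])
      show "fst (g, l) \<in> G \<and> B \<in> blk (fst (g, l)) (snd (g, l))" using g in_lin Bl by simp
    next
      fix t' assume t': "fst t' \<in> G \<and> B \<in> blk (fst t') (snd t')"
      obtain g' l' where gl: "t' = (g', l')" by fastforce
      have "B \<notin> gen g' j" for j using gen_not_flat[OF _ m(3,2)] by blast
      then have "B \<in> lin g' l'" using t' gl Bl by auto
      then obtain u' b'' where u': "u' \<in> U" "b'' \<in> Fam l'" "B = emb g' u' ` b''" "B \<subseteq> flat g' u'"
        by (rule lin_flat)
      obtain x a y e where xy: "Some (x, a) \<in> B" "Some (y, e) \<in> B" "x \<noteq> y"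
        by (rule distinct_places[OF B]) (use no_axis in blast)+
      have "x - g' \<in> line u'" "y - g' \<in> line u'" "x - m \<in> line u" "y - m \<in> line u"
        using xy u'(4) m(3) by (auto simp: flat_def)
      \<comment> \<open>The nonzero difference x - y lies on both lines, so they agree.\<close>
      then have "x - y \<in> line u'" "x - y \<in> line u" using line_diff by fastforce+
      then have "u' = u" using U_unique[OF u'(1) m(2)] xy(3) by simp
      then have "g' - m \<in> line u"
        using line_diff[OF \<open>x - m \<in> line u\<close>, of "x - g'"] \<open>x - g' \<in> line u'\<close> by simp
      then obtain c' where c': "c' < q" "g' - m = of_nat c' * u" by (rule line_nat)
      have g': "g' = m + of_nat c' * u" using c'(2) by (simp add: algebra_simps)
      have "emb m u ` trm c' ` b'' = emb g' u ` b''"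
        unfolding g' by (rule emb_trm_image[OF u'(2)])
      also have "\<dots> = B" using u'(3) \<open>u' = u\<close> by (simp only:)
      also have "B = emb m u ` b" by (rule Bb)
      finally have "emb m u ` trm c' ` b'' = emb m u ` b" .
      then have "trm c' ` b'' = b"
        using inj_on_image_eq_iff[OF emb_inj[OF m(2)] trm_Fam[OF u'(2)] b] by (simp only:)
      then have "(c', l') = t" using t_uniq c'(1) u'(2) by auto
      then show "t' = (g, l)" using cl gl g' g_def by simp
    qed
  next
    case no_flat: False
    obtain p p' p'' where p: "B = {p, p', p''}" "p \<noteq> p'" "p \<noteq> p''" "p' \<noteq> p''"
      using B(2) by (rule card_3_obtain)
    have not_None: "r \<noteq> None" if r: "B = {r, s, t}" for r s t
    proof
      assume None: "r = None"
      have "s \<in> X" "t \<in> X" using B(1) r by auto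
      then obtain m u where "m \<in> G" "u \<in> U" "s \<in> flat m u" "t \<in> flat m u" by (rule pair_flat)
      then have "m \<in> G" "u \<in> U" "B \<subseteq> flat m u" using r None by (auto simp: flat_def)
      then show False using no_flat by blast
    qed
    have "p \<noteq> None" "p' \<noteq> None" "p'' \<noteq> None"
      using not_None[of p p' p''] not_None[of p' p p''] not_None[of p'' p p'] p(1)
      by (simp_all add: insert_commute)
    then obtain x a y b z c where xyz: "p = Some (x, a)" "p' = Some (y, b)" "p'' = Some (z, c)"
      by (metis not_None_eq surj_pair)
    have G: "x \<in> G" "y \<in> G" "z \<in> G" using B(1) p xyz by (auto simp: X_def)
    \<comment> \<open>The sum rules need an even number of points off level j, so the levels alone
      fix j.\<close>
    define j where "j = (c = (a = b))"
    have j: "(a = b) = (c = j') \<longleftrightarrow> j' = j" for j' unfolding j_def by blast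
    obtain k where k: "\<And>g. sg j a (x - g) + sg j b (y - g) + sg j c (z - g) = 0 \<longleftrightarrow>
        g = of_int k * (sg j a x + sg j b y + sg j c z)"
      using j[of j] centre[of a b c j] by metis
    define g where "g = of_int k * (sg j a x + sg j b y + sg j c z)"
    have g: "g \<in> G" unfolding g_def using G sg_closed add_G of_int_mult_G by simp
    have sum: "sg j a (x - g) + sg j b (y - g) + sg j c (z - g) = 0" using k g_def by blast
    \<comment> \<open>If two of the three signed vectors lie on a line, so does the third, and the
      triple would be inside a flat through g.\<close>
    have two: "sg j a (x - g) \<in> line u \<Longrightarrow> sg j b (y - g) \<in> line u \<Longrightarrow> sg j c (z - g) \<in> line u"
      "sg j a (x - g) \<in> line u \<Longrightarrow> sg j c (z - g) \<in> line u \<Longrightarrow> sg j b (y - g) \<in> line u"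
      "sg j b (y - g) \<in> line u \<Longrightarrow> sg j c (z - g) \<in> line u \<Longrightarrow> sg j a (x - g) \<in> line u" for u
      by (rule line_sum_zero[of _ _ _ u]; use sum in \<open>simp only: add_ac\<close>)+
    have not_all: "\<not> (x - g \<in> line u \<and> y - g \<in> line u \<and> z - g \<in> line u)" if u: "u \<in> U" for u
    proof
      assume "x - g \<in> line u \<and> y - g \<in> line u \<and> z - g \<in> line u"
      then have "B \<subseteq> flat g u" using p xyz by (auto simp: flat_def)
      then show False using no_flat g u by blast
    qed
    have "indep g x y" "indep g x z" "indep g y z"
      using two not_all unfolding sg_sg indep_def by blast+
    then have rel: "gen_rel g j (x, a) (y, b) (z, c)"
      using G sum j[of j] by (simp add: gen_rel_def)
    have no_lin: "B \<notin> lin g' l" if "g' \<in> G" for g' l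
    proof
      assume "B \<in> lin g' l"
      then obtain u where "u \<in> U" "B \<subseteq> flat g' u" by (rule lin_flat)
      then show False using no_flat that by blast
    qed
    show ?thesis
    proof (rule ex1I[of _ "(g, Some j)"])
      have "B \<in> gen g j" using rel p(1) xyz unfolding gen_def by blast
      then show "fst (g, Some j) \<in> G \<and> B \<in> blk (fst (g, Some j)) (snd (g, Some j))"
        using g by simp
    next
      fix t assume t: "fst t \<in> G \<and> B \<in> blk (fst t) (snd t)"
      then obtain g' j' where g': "t = (g', Some j')" "B \<in> gen g' j'"
        using Bl[of "fst t" "snd t"] no_lin[of "fst t" "snd t"] by (metis prod.collapse)
      have "Some (x, a) \<in> B" "Some (y, b) \<in> B" "(x, a) \<noteq> (y, b)" using p(1,2) xyz(1,2) by auto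
      then obtain s where s: "B = {Some (x, a), Some (y, b), Some s}" "gen_rel g' j' (x, a) (y, b) s"
        by (rule gen_obtain[OF g'(2)])
      have "p'' \<in> {Some (x, a), Some (y, b), Some s}" using p(1) s(1) by blast
      then have "s = (z, c)" using p(3,4) xyz by auto
      then have rel': "(a = b) = (c = j')" "sg j' a (x - g') + sg j' b (y - g') + sg j' c (z - g') = 0"
        using s(2) by (simp_all add: gen_rel_def)
      then have "j' = j" using j by blast
      then show "t = (g, Some j)" using rel'(2) k g'(1) g_def by blast
    qed
  qed
qed

declare blk.simps [simp del]

end

text \<open>A triple labelled \<open>None\<close> at centre g belongs to the classes of (g, False)
  and (g, True); one labelled \<open>Some j\<close> belongs to the single index (g, j).\<close>

sublocale lifting \<subseteq> large_set X "G \<times> (UNIV :: bool set)" "\<lambda>(g, j). blk g None" "\<lambda>(g, j). blk g (Some j)"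
proof
  show "finite (G \<times> (UNIV :: bool set))" "finite X" using finite_G by (simp_all add: X_def)
  show "card X = card (G \<times> (UNIV :: bool set)) + 1"
    using finite_G by (simp add: X_def card_image card_cartesian_product image_iff)
  fix d :: "'v \<times> bool" assume d: "d \<in> G \<times> (UNIV :: bool set)"
  obtain g j where gj: "d = (g, j)" "g \<in> G" using d by auto
  show "B \<subseteq> X \<and> card B = 3" if "B \<in> (case d of (g, j) \<Rightarrow> blk g None) \<union> (case d of (g, j) \<Rightarrow> blk g (Some j))"
    for B using that blk_sub[OF gj(2)] unfolding gj(1) prod.case Un_iff by blast
  show "\<exists>!B. B \<in> (case d of (g, j) \<Rightarrow> blk g None) \<and> x \<in> B" if "x \<in> X" for x
    using blk_parallel[OF gj(2) that] gj(1) by simp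
  show "\<exists>!B. B \<in> (case d of (g, j) \<Rightarrow> blk g None) \<union> (case d of (g, j) \<Rightarrow> blk g (Some j)) \<and> x \<in> B \<and> y \<in> B"
    if "x \<in> X" "y \<in> X" "x \<noteq> y" for x y
    using blk_pair[OF gj(2) that, of j] unfolding gj(1) prod.case .
next
  fix B assume B: "B \<subseteq> X" "card B = 3"
  from ex1_blk[OF B] obtain t where t: "fst t \<in> G \<and> B \<in> blk (fst t) (snd t)"
    and uniq: "\<forall>t'. fst t' \<in> G \<and> B \<in> blk (fst t') (snd t') \<longrightarrow> t' = t" by (rule ex1E)
  have uniq': "g = fst t \<and> l = snd t" if "g \<in> G" "B \<in> blk g l" for g l
    using uniq[rule_format, of "(g, l)"] that by (metis fst_conv snd_conv)
  show "card {d \<in> G \<times> (UNIV :: bool set). B \<in> (case d of (g, j) \<Rightarrow> blk g None)} = 2 \<and>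
      (\<forall>d\<in>G \<times> (UNIV :: bool set). B \<notin> (case d of (g, j) \<Rightarrow> blk g (Some j))) \<or>
    (\<forall>d\<in>G \<times> (UNIV :: bool set). B \<notin> (case d of (g, j) \<Rightarrow> blk g None)) \<and>
      (\<exists>!d. d \<in> G \<times> (UNIV :: bool set) \<and> B \<in> (case d of (g, j) \<Rightarrow> blk g (Some j)))"
  proof (cases "snd t")
    case None
    have eq: "{d \<in> G \<times> (UNIV :: bool set). B \<in> (case d of (g, j) \<Rightarrow> blk g None)} = {fst t} \<times> (UNIV :: bool set)"
      using uniq' t None by auto
    have "\<forall>d\<in>G \<times> (UNIV :: bool set). B \<notin> (case d of (g, j) \<Rightarrow> blk g (Some j))"
      using uniq' None by fastforce
    moreover have "card {d \<in> G \<times> (UNIV :: bool set). B \<in> (case d of (g, j) \<Rightarrow> blk g None)} = 2"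
      unfolding eq by (simp add: card_cartesian_product)
    ultimately show ?thesis by blast
  next
    case (Some j)
    have "\<forall>d\<in>G \<times> (UNIV :: bool set). B \<notin> (case d of (g, j) \<Rightarrow> blk g None)"
      using uniq' Some by fastforce
    moreover have "\<exists>!d. d \<in> G \<times> (UNIV :: bool set) \<and> B \<in> (case d of (g, j) \<Rightarrow> blk g (Some j))"
    proof (rule ex1I[of _ "(fst t, j)"])
      fix d :: "'v \<times> bool" assume d: "d \<in> G \<times> (UNIV :: bool set) \<and> B \<in> (case d of (g, j) \<Rightarrow> blk g (Some j))"
      obtain g j' where "d = (g, j')" by fastforce
      then show "d = (fst t, j)" using uniq'[of g "Some j'"] d Some by auto
    qed (use t Some in auto)
    ultimately show ?thesis by blast
  qed
qed

section \<open>The base designs for 7 and 13\<close>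

fun merge :: "'a :: linorder list \<Rightarrow> 'a list \<Rightarrow> 'a list" where
  "merge [] ys = ys"
| "merge xs [] = xs"
| "merge (x # xs) (y # ys) = (if x \<le> y then x # merge xs (y # ys) else y # merge (x # xs) ys)"

fun merge_pairs :: "'a :: linorder list list \<Rightarrow> 'a list list" where
  "merge_pairs (xs # ys # zss) = merge xs ys # merge_pairs zss"
| "merge_pairs xss = xss"

lemma length_merge_pairs: "length (merge_pairs xss) \<le> length xss"
  by (induction xss rule: merge_pairs.induct) auto

function merge_all :: "'a :: linorder list list \<Rightarrow> 'a list" where
  "merge_all [] = []"
| "merge_all [xs] = xs"
| "merge_all (xs # ys # zss) = merge_all (merge xs ys # merge_pairs zss)"
  by pat_completeness auto
termination
  by (relation "measure length") (auto simp: less_Suc_eq_le length_merge_pairs)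

text \<open>
  Merge sort is used because simplification with the code equations of \<open>sort\<close> (a quicksort)
  is too slow on long lists.
\<close>

definition "msort xs = merge_all (map (\<lambda>x. [x]) xs)"

lemma mset_merge: "mset (merge xs ys) = mset xs + mset ys"
  by (induction xs ys rule: merge.induct) auto

lemma mset_merge_pairs: "(\<Sum>xs\<leftarrow>merge_pairs xss. mset xs) = (\<Sum>xs\<leftarrow>xss. mset xs)"
  by (induction xss rule: merge_pairs.induct) (auto simp: mset_merge)

lemma mset_merge_all: "mset (merge_all xss) = (\<Sum>xs\<leftarrow>xss. mset xs)"
  by (induction xss rule: merge_all.induct) (auto simp: mset_merge mset_merge_pairs add.assoc)

lemma mset_msort [simp]: "mset (msort xs) = mset xs"
proof -
  have "(\<Sum>xs\<leftarrow>map (\<lambda>x. [x]) xs. mset xs) = mset xs" by (induction xs) auto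
  then show ?thesis by (simp add: msort_def mset_merge_all del: map_map)
qed

lemma set_msort [simp]: "set (msort xs) = set xs"
  by (metis mset_msort set_mset_mset)

lemma distinct_msort [simp]: "distinct (msort xs) = distinct xs"
  by (metis mset_msort mset_eq_imp_distinct_iff)

lemma ex1_concat:
  assumes "distinct (concat (map f xs))" "y \<in> set (concat (map f xs))"
  shows "\<exists>!x. x \<in> set xs \<and> y \<in> set (f x)"
  using assms
proof (induction xs)
  case (Cons x xs)
  show ?case
  proof (cases "y \<in> set (f x)")
    case True
    then have "y \<notin> set (f x')" if "x' \<in> set xs" for x' using Cons.prems(1) that by auto
    then show ?thesis using True by (intro ex1I[of _ x]) auto
  next
    case False
    then have "\<exists>!x. x \<in> set xs \<and> y \<in> set (f x)" using Cons by auto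
    then show ?thesis using False by (metis list.set_intros(2) set_ConsD)
  qed
qed simp

text \<open>Strict monotonicity of the sorted concatenation excludes repetitions. Unique existence
  thus becomes an equality of lists that evaluation can decide.\<close>

lemma ex1_sorted_listing:
  assumes "msort (concat (map f xs)) = ys" "successively (<) ys" "y \<in> set ys"
  shows "\<exists>!x. x \<in> set xs \<and> y \<in> set (f x)"
proof (rule ex1_concat)
  have "sorted_wrt (<) ys"
    using assms(2) by (subst (asm) successively_conv_sorted_wrt) (auto intro: transpI)
  then have "distinct ys" by (simp add: strict_sorted_iff)
  then show "distinct (concat (map f xs))" using assms(1) by (metis distinct_msort)
  show "y \<in> set (concat (map f xs))" using assms(1,3) by (metis set_msort)
qed

section \<open>Evaluable conditions on a base design\<close>

context base_design begin

definition pairs :: "nat list \<Rightarrow> nat list list" where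
  "pairs b = (case b of [x, y, z] \<Rightarrow> [[x, y], [x, z], [y, z]] | _ \<Rightarrow> [])"

definition all_pairs :: "nat list list" where
  "all_pairs = [[x, y]. x \<leftarrow> [0..<2 * q + 1], y \<leftarrow> [x + 1..<2 * q + 1],
     \<not> (x \<in> set [0, 1, 2 * q] \<and> y \<in> set [0, 1, 2 * q])]"

text \<open>The excluded lists \<open>[0, 1, 2 * q]\<close> and \<open>[1, 0, 2 * q]\<close> are the
  anchored forms of the vertical triples.\<close>

definition all_anchored :: "nat list list" where
  "all_anchored = [[a, y, z]. a \<leftarrow> [0, 1], y \<leftarrow> [0..<2 * q + 1], z \<leftarrow> [y + 1..<2 * q + 1],
     y \<noteq> a \<and> z \<noteq> a \<and> \<not> (y + a = 1 \<and> z = 2 * q)]"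

text \<open>
  Every triple has a translate in which a given finite point of it has residue 0. Hence the
  translates of the blocks are all triples, each once, as soon as the pairs of a block and a
  finite point of it, moved to residue 0, yield each anchored triple once.
\<close>

definition marked :: "(bool option \<Rightarrow> nat list list) \<Rightarrow> (bool option \<times> nat list \<times> nat) list" where
  "marked bl = [(l, b, k). l \<leftarrow> [None, Some False, Some True], b \<leftarrow> bl l, k \<leftarrow> b, k \<noteq> 2 * q]"

definition anchor :: "bool option \<times> nat list \<times> nat \<Rightarrow> nat list" where
  "anchor = (\<lambda>(l, b, k). (k mod 2) # sort (map (trm (q - k div 2)) (remove1 k b)))"

definition check :: "(bool option \<Rightarrow> nat list list) \<Rightarrow> bool" where
  "check bl \<longleftrightarrow>
     list_all (\<lambda>l. list_all (\<lambda>b. length b = 3 \<and> successively (<) b \<and> list_all (\<lambda>k. k \<le> 2 * q) b) (bl l))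
       [None, Some False, Some True] \<and>
     msort (concat (bl None)) = [2..<2 * q] \<and>
     list_all (\<lambda>j. msort (concat (map pairs (bl None @ bl (Some j)))) = all_pairs) [False, True] \<and>
     successively (<) all_pairs \<and>
     msort (map anchor (marked bl)) = all_anchored \<and> successively (<) all_anchored"

end

definition dilate :: "nat \<Rightarrow> nat \<Rightarrow> nat \<Rightarrow> nat" where
  "dilate q c k = (if k = 2 * q then k else 2 * ((c * (k div 2)) mod q) + k mod 2)"

text \<open>\<open>remdups\<close> is needed for blocks fixed by the multipliers, such as
  \<open>[2, 4, 8]\<close> for q = 7, whose residues 1, 2, 4 are the cube roots of unity.\<close>

definition orbits :: "nat \<Rightarrow> nat list \<Rightarrow> nat list list \<Rightarrow> nat list list" where
  "orbits q H bs = concat (map (\<lambda>b. remdups (map (\<lambda>c. msort (map (dilate q c) b)) H)) bs)"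

text \<open>
  The designs below were found by an exact cover search among those invariant under
  multiplication by the cube roots of unity modulo \<open>q\<close>.
\<close>

fun bl7 :: "bool option \<Rightarrow> nat list list" where
  "bl7 None = orbits 7 [1, 2, 4] [[2, 4, 8], [3, 6, 11]]"
| "bl7 (Some False) = orbits 7 [1, 2, 4]
    [[0, 2, 3], [0, 6, 7], [1, 2, 13], [1, 3, 12], [2, 5, 9], [2, 6, 12],
     [2, 7, 10], [2, 11, 14], [3, 7, 13], [3, 10, 14]]"
| "bl7 (Some True) = orbits 7 [1, 2, 4]
    [[0, 2, 13], [0, 3, 10], [1, 2, 3], [1, 6, 7], [2, 5, 10], [2, 6, 14],
     [2, 7, 9], [2, 11, 12], [3, 5, 9], [3, 7, 14], [6, 10, 12], [7, 11, 13]]"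

fun bl13 :: "bool option \<Rightarrow> nat list list" where
  "bl13 None = orbits 13 [1, 3, 9] [[2, 6, 18], [3, 10, 25], [5, 20, 22], [15, 17, 23]]"
| "bl13 (Some False) = orbits 13 [1, 3, 9]
    [[0, 2, 22], [0, 3, 8], [0, 4, 25], [0, 5, 17], [1, 2, 23], [1, 3, 11],
     [1, 4, 8], [1, 9, 16], [2, 3, 16], [2, 4, 19], [2, 5, 15], [2, 7, 14],
     [2, 8, 21], [2, 9, 11], [2, 10, 24], [2, 12, 20], [2, 13, 25], [2, 17, 26],
     [3, 4, 26], [3, 5, 19], [3, 9, 15], [3, 14, 17], [3, 20, 23], [3, 21, 24],
     [4, 5, 16], [4, 9, 17], [4, 10, 12], [4, 11, 22], [4, 13, 15], [4, 14, 23],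
     [5, 8, 11], [5, 21, 26], [8, 9, 23], [8, 16, 17], [8, 20, 24], [8, 22, 26],
     [9, 14, 25], [14, 16, 22]]"
| "bl13 (Some True) = orbits 13 [1, 3, 9]
    [[0, 2, 12], [0, 3, 24], [0, 5, 16], [0, 9, 23], [1, 2, 4], [1, 3, 22],
     [1, 5, 25], [1, 8, 15], [2, 3, 13], [2, 5, 24], [2, 7, 23], [2, 8, 20],
     [2, 9, 10], [2, 11, 21], [2, 14, 19], [2, 15, 16], [2, 17, 25], [2, 22, 26],
     [3, 4, 12], [3, 5, 8], [3, 7, 19], [3, 9, 14], [3, 11, 15], [3, 20, 21],
     [3, 23, 26], [4, 5, 23], [4, 8, 17], [4, 9, 22], [4, 11, 26], [4, 13, 16],
     [4, 14, 20], [4, 15, 24], [5, 11, 13], [5, 15, 21], [8, 21, 26], [8, 22, 25],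
     [9, 21, 25], [14, 15, 22]]"

lemmas [code] = base_design.pairs_def base_design.all_pairs_def base_design.all_anchored_def
  base_design.marked_def base_design.anchor_def base_design.check_def

text \<open>An anchoring shift is at most q, so the sum stays below 4 q and one subtraction replaces
  \<open>mod\<close> during evaluation.\<close>

lemma trm_code [code]: "base_design.trm q c k =
  (if k = 2 * q then k else let m = k + 2 * c in if m < 2 * q then m
   else if m < 4 * q then m - 2 * q else m mod (2 * q))"
  by (auto simp: base_design.trm_def Let_def le_mod_geq)

lemma check7: "base_design.check 7 bl7" by code_simp

lemma check13: "base_design.check 13 bl13" by code_simp

section \<open>From the evaluated check to a base design\<close>

lemma sorted_list_cases3:
  assumes "length b = 3" "successively (<) b"
  obtains x y z :: nat where "b = [x, y, z]" "x < y" "y < z"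
  using assms by (auto simp: numeral_3_eq_3 length_Suc_conv)

lemma set_if_singleton: "x \<in> set (if c then [e] else []) \<longleftrightarrow> c \<and> x = e"
  by auto

locale checked_base = base_design q Fam for q Fam +
  fixes bl :: "bool option \<Rightarrow> nat list list"
  assumes check: "check bl" and q_ge_2: "2 \<le> q" and Fam_eq: "Fam = (\<lambda>l. set ` set (bl l))"
begin

lemma labels: "set [None, Some False, Some True] = (UNIV :: bool option set)"
  by (auto simp: UNIV_option_conv UNIV_bool)

lemma block_cases:
  assumes "b \<in> set (bl l)"
  obtains x y z where "b = [x, y, z]" "x < y" "y < z" "z \<le> 2 * q"
proof -
  have "l \<in> set [None, Some False, Some True]" by (simp only: labels UNIV_I)
  then have b: "length b = 3" "successively (<) b" "list_all (\<lambda>k. k \<le> 2 * q) b"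
    using check assms unfolding check_def list_all_iff by auto
  obtain x y z where "b = [x, y, z]" "x < y" "y < z" using b(1,2) by (rule sorted_list_cases3)
  then show ?thesis using that b(3) by simp
qed

lemma pairs_iff:
  assumes "b \<in> set (bl l)" "x < y"
  shows "[x, y] \<in> set (pairs b) \<longleftrightarrow> x \<in> set b \<and> y \<in> set b"
  using assms by (elim block_cases) (auto simp: pairs_def)

lemma mem_all_pairs:
  "[x, y] \<in> set all_pairs \<longleftrightarrow> x < y \<and> y \<le> 2 * q \<and> \<not> (x \<in> core \<and> y \<in> core)"
  by (auto simp: all_pairs_def core_def)

lemma listing_pairs: "msort (concat (map pairs (bl None @ bl (Some j)))) = all_pairs"
  using check unfolding check_def by (cases j) auto

lemma block_pair:
  assumes "x < y" "y \<le> 2 * q" "\<not> (x \<in> core \<and> y \<in> core)"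
  shows "\<exists>!b. b \<in> Fam None \<union> Fam (Some j) \<and> x \<in> b \<and> y \<in> b"
proof -
  have "successively (<) all_pairs" using check by (simp add: check_def)
  then have "\<exists>!b. b \<in> set (bl None @ bl (Some j)) \<and> [x, y] \<in> set (pairs b)"
    by (rule ex1_sorted_listing[OF listing_pairs]) (use assms in \<open>simp add: mem_all_pairs\<close>)
  then obtain b where b: "b \<in> set (bl None @ bl (Some j)) \<and> [x, y] \<in> set (pairs b)"
    and uniq: "\<forall>b'. b' \<in> set (bl None @ bl (Some j)) \<and> [x, y] \<in> set (pairs b') \<longrightarrow> b' = b"
    by (rule ex1E)
  show ?thesis
  proof (rule ex1I[of _ "set b"])
    show "set b \<in> Fam None \<union> Fam (Some j) \<and> x \<in> set b \<and> y \<in> set b"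
      using b pairs_iff[OF _ assms(1)] by (auto simp: Fam_eq)
  next
    fix B assume B: "B \<in> Fam None \<union> Fam (Some j) \<and> x \<in> B \<and> y \<in> B"
    then obtain b' where b': "b' \<in> set (bl None @ bl (Some j))" "B = set b'"
      by (auto simp: Fam_eq)
    then have "[x, y] \<in> set (pairs b')" using B pairs_iff[OF _ assms(1)] by auto
    then show "B = set b" using uniq b' by blast
  qed
qed

text \<open>Two core points in a block would appear in the listing of pairs, which omits
  them.\<close>

lemma block_core:
  assumes "b \<in> Fam l" "x \<in> b" "y \<in> b" "x \<in> core" "y \<in> core" shows "x = y"
proof -
  have no: False if xy: "x < y" "x \<in> b" "y \<in> b" "x \<in> core" "y \<in> core" for x y
  proof -
    obtain bs where bs: "bs \<in> set (bl l)" "b = set bs" using assms(1) by (auto simp: Fam_eq)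
    then have "[x, y] \<in> set (pairs bs)" using pairs_iff[OF bs(1) xy(1)] xy by simp
    moreover obtain j where "bs \<in> set (bl None @ bl (Some j))" using bs(1) by (cases l) auto
    ultimately have "[x, y] \<in> set (msort (concat (map pairs (bl None @ bl (Some j)))))" by auto
    then show False using xy unfolding listing_pairs mem_all_pairs by blast
  qed
  show ?thesis using no[of x y] no[of y x] assms by (metis linorder_neqE_nat)
qed

lemma listing_parallel: "msort (concat (bl None)) = [2..<2 * q]"
  using check by (simp add: check_def)

lemma block_avoid:
  assumes "b \<in> Fam None" shows "b \<inter> core = {}"
proof -
  have "set (concat (bl None)) = {2..<2 * q}"
    by (metis listing_parallel set_msort set_upt)
  moreover have "b \<subseteq> set (concat (bl None))" using assms by (auto simp: Fam_eq)
  ultimately have "b \<subseteq> {2..<2 * q}" by simp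
  then show ?thesis by (auto simp: core_def)
qed

lemma block_parallel:
  assumes "x \<le> 2 * q" "x \<notin> core" shows "\<exists>!b. b \<in> Fam None \<and> x \<in> b"
proof -
  have "sorted_wrt (<) [2..<2 * q]" by simp
  then have "successively (<) [2..<2 * q]" by (rule successively_if_sorted_wrt)
  moreover have "x \<in> set [2..<2 * q]" using assms by (auto simp: core_def)
  ultimately have "\<exists>!b. b \<in> set (bl None) \<and> x \<in> set (id b)"
    using ex1_sorted_listing[of id "bl None"] listing_parallel by simp
  then show ?thesis unfolding Fam_eq by (auto simp: image_iff)
qed

section \<open>Rotations of the base points\<close>

lemma trm_parity:
  assumes "k < 2 * q"
  shows "trm c k mod 2 = k mod 2" "trm c k div 2 = (k div 2 + c) mod q" "trm c k < 2 * q"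
proof -
  have "trm c k = 2 * ((k div 2 + c) mod q) + k mod 2"
    using assms by (simp add: trm_def mod_mult2_eq add.commute)
  then show "trm c k mod 2 = k mod 2" "trm c k div 2 = (k div 2 + c) mod q" by simp_all
  show "trm c k < 2 * q" using assms by (simp add: trm_def)
qed

lemma half_eqI: "k mod 2 = k' mod 2 \<Longrightarrow> k div 2 = k' div 2 \<Longrightarrow> k = k'" for k k' :: nat
  by (metis div_mult_mod_eq)

lemma trm_trm: "k \<le> 2 * q \<Longrightarrow> trm c (trm d k) = trm (d + c) k"
proof (cases "k = 2 * q")
  case False
  assume "k \<le> 2 * q"
  then have k: "k < 2 * q" using False by simp
  show ?thesis
    by (rule half_eqI) (simp_all add: trm_parity k trm_parity[OF trm_parity(3)[OF k]] mod_simps add.assoc)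
qed (simp add: trm_def)

lemma trm_cong: "k \<le> 2 * q \<Longrightarrow> c mod q = d mod q \<Longrightarrow> trm c k = trm d k"
proof (cases "k = 2 * q")
  case False
  assume "k \<le> 2 * q" and eq: "c mod q = d mod q"
  then have k: "k < 2 * q" using False by simp
  have "(k div 2 + c) mod q = (k div 2 + d) mod q" using eq by (metis mod_add_right_eq)
  then show ?thesis by (rule_tac half_eqI) (simp_all only: trm_parity[OF k])
qed (simp add: trm_def)

lemma trm_multiple: "k \<le> 2 * q \<Longrightarrow> c mod q = 0 \<Longrightarrow> trm c k = k"
  using trm_cong[of k c 0] by (cases "k = 2 * q") (simp_all add: trm_def)

lemma trm_le: "k \<le> 2 * q \<Longrightarrow> trm c k \<le> 2 * q"
  using trm_parity(3)[of k c] by (cases "k = 2 * q") (auto simp: trm_def less_imp_le)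

lemma image_trm_trm: "B \<subseteq> {..2 * q} \<Longrightarrow> trm c ` trm d ` B = trm (d + c) ` B"
  unfolding image_image by (intro image_cong refl trm_trm) auto

lemma image_trm_cong: "B \<subseteq> {..2 * q} \<Longrightarrow> c mod q = d mod q \<Longrightarrow> trm c ` B = trm d ` B"
  by (intro image_cong refl trm_cong) auto

lemma image_trm_multiple:
  assumes "B \<subseteq> {..2 * q}" "c mod q = 0" shows "trm c ` B = B"
proof -
  have "trm c k = id k" if "k \<in> B" for k using trm_multiple[of k c] assms that by auto
  then have "trm c ` B = id ` B" by (rule image_cong[OF refl])
  then show ?thesis by simp
qed

lemma image_trm_sub: "B \<subseteq> {..2 * q} \<Longrightarrow> trm c ` B \<subseteq> {..2 * q}"
  by (rule image_subsetI) (use trm_le in \<open>simp add: subset_iff\<close>)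

lemma trm_inj: "inj_on (trm c) {..2 * q}"
proof (rule inj_on_inverseI[of _ "trm (q - c mod q)"])
  fix k assume k: "k \<in> {..2 * q}"
  have "(c + (q - c mod q)) mod q = (c mod q + (q - c mod q)) mod q" by (simp only: mod_add_left_eq)
  also have "\<dots> = 0" using q_ge_2 by simp
  finally show "trm (q - c mod q) (trm c k) = k" using k by (simp add: trm_trm trm_multiple)
qed

lemma block_sub: "b \<in> set (bl l) \<Longrightarrow> set b \<subseteq> {..2 * q}"
  by (elim block_cases) auto

lemma block_card: "b \<in> set (bl l) \<Longrightarrow> card (set b) = 3"
  by (elim block_cases) auto

lemma trm_anchor: "k < 2 * q \<Longrightarrow> trm (q - k div 2) k = k mod 2"
  by (rule half_eqI) (auto simp: trm_parity)

text \<open>The rotation takes the marked point k to the code \<open>k mod 2\<close>, and sorting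
  the other two images makes the list a normal form for the rotated block together with its
  mark.\<close>

lemma anchor_iff:
  assumes b: "b \<in> set (bl l)" and k: "k \<in> set b" "k < 2 * q" and yz: "y < z" "a \<noteq> y" "a \<noteq> z"
  shows "anchor (l, b, k) = [a, y, z] \<longleftrightarrow> a = k mod 2 \<and> trm (q - k div 2) ` set b = {a, y, z}"
proof -
  let ?t = "trm (q - k div 2)"
  have dist: "distinct b" using b by (auto elim!: block_cases)
  have inj: "inj_on ?t (set b)" by (rule inj_on_subset[OF trm_inj block_sub[OF b]])
  let ?r = "map ?t (remove1 k b)"
  have r: "distinct ?r" "set ?r = ?t ` set b - {k mod 2}"
  proof -
    have rem: "set (remove1 k b) = set b - {k}" using dist by (rule set_remove1_eq)
    then show "distinct ?r"
      using dist inj by (auto simp: distinct_map distinct_remove1 intro: inj_on_subset)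
    show "set ?r = ?t ` set b - {k mod 2}"
      using rem inj_on_image_set_diff[OF inj, of "set b" "{k}"] k trm_anchor[OF k(2)] by auto
  qed
  have sort: "sort ?r = [y, z] \<longleftrightarrow> set ?r = {y, z}"
  proof
    assume "set ?r = {y, z}"
    then show "sort ?r = [y, z]"
      using r(1) yz(1) by (intro sorted_distinct_set_unique) auto
  qed (metis set_sort list.set(1,2))
  have mem: "k mod 2 \<in> ?t ` set b" using trm_anchor[OF k(2)] k(1) by (metis imageI)
  have remove: "S - {a} = {y, z} \<longleftrightarrow> S = {a, y, z}" if "a \<in> S" for S
    using yz(2,3) that by blast
  have "anchor (l, b, k) = [a, y, z] \<longleftrightarrow> a = k mod 2 \<and> sort ?r = [y, z]"
    by (auto simp: anchor_def)
  also have "\<dots> \<longleftrightarrow> a = k mod 2 \<and> ?t ` set b - {k mod 2} = {y, z}"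
    by (simp only: sort r(2))
  also have "\<dots> \<longleftrightarrow> a = k mod 2 \<and> ?t ` set b = {a, y, z}"
    using remove[of "?t ` set b"] mem by metis
  finally show ?thesis .
qed

lemma mem_all_anchored:
  "[a, y, z] \<in> set all_anchored \<longleftrightarrow>
    a < 2 \<and> y < z \<and> z \<le> 2 * q \<and> y \<noteq> a \<and> z \<noteq> a \<and> \<not> (y + a = 1 \<and> z = 2 * q)"
proof -
  have "[a, y, z] \<in> set all_anchored \<longleftrightarrow> (\<exists>a'\<in>{0, 1}. \<exists>y'\<in>{0..<2 * q + 1}. \<exists>z'\<in>{y' + 1..<2 * q + 1}.
      (y' \<noteq> a' \<and> z' \<noteq> a' \<and> \<not> (y' + a' = 1 \<and> z' = 2 * q)) \<and> [a, y, z] = [a', y', z'])"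
    unfolding all_anchored_def set_concat set_map set_upt UN_iff image_image bex_simps set_if_singleton list.set
    by blast
  also have "\<dots> \<longleftrightarrow> a \<in> {0, 1} \<and> y \<in> {0..<2 * q + 1} \<and> z \<in> {y + 1..<2 * q + 1} \<and>
      y \<noteq> a \<and> z \<noteq> a \<and> \<not> (y + a = 1 \<and> z = 2 * q)"
    by blast
  also have "\<dots> \<longleftrightarrow> a < 2 \<and> y < z \<and> z \<le> 2 * q \<and> y \<noteq> a \<and> z \<noteq> a \<and> \<not> (y + a = 1 \<and> z = 2 * q)"
  proof -
    have "a \<in> {0, 1} \<longleftrightarrow> a < 2" by auto
    moreover have "y \<in> {0..<2 * q + 1} \<and> z \<in> {y + 1..<2 * q + 1} \<longleftrightarrow> y < z \<and> z \<le> 2 * q" by auto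
    ultimately show ?thesis by blast
  qed
  finally show ?thesis .
qed

lemma mem_marked: "(l, b, k) \<in> set (marked bl) \<longleftrightarrow> b \<in> set (bl l) \<and> k \<in> set b \<and> k < 2 * q"
proof -
  have "(l, b, k) \<in> set (marked bl) \<longleftrightarrow> b \<in> set (bl l) \<and> k \<in> set b \<and> k \<noteq> 2 * q"
    unfolding marked_def set_concat set_map UN_iff image_image bex_simps labels set_if_singleton by blast
  moreover have "k \<le> 2 * q" if "b \<in> set (bl l)" "k \<in> set b" using block_sub that by auto
  ultimately show ?thesis by (auto simp: less_le)
qed

lemma trm_vert:
  assumes "c < q" shows "trm c ` vert 0 = vert c"
proof -
  have "trm c 0 = 2 * c" "trm c 1 = 2 * c + 1" "trm c (2 * q) = 2 * q"
    using assms q_ge_2 by (simp_all add: trm_def)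
  then show ?thesis by (simp add: vert_def)
qed

lemma vert_sub: "c < q \<Longrightarrow> vert c \<subseteq> {..2 * q}"
  by (auto simp: vert_def)

lemma trm_vert':
  assumes "c < q" shows "trm (q - c) ` vert c = vert 0"
proof -
  have sub: "vert 0 \<subseteq> {..2 * q}" using vert_sub[of 0] q_ge_2 by simp
  have "trm (q - c) ` vert c = trm (q - c) ` trm c ` vert 0" by (simp only: trm_vert[OF assms])
  also have "\<dots> = trm (c + (q - c)) ` vert 0" by (rule image_trm_trm[OF sub])
  also have "\<dots> = vert 0" using assms by (intro image_trm_multiple[OF sub]) simp
  finally show ?thesis .
qed

lemma listing_anchored: "msort (concat (map (\<lambda>m. [anchor m]) (marked bl))) = all_anchored"
  using check by (simp add: check_def)

text \<open>Marked at its point of level 0, a vertical block would be anchored to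
  \<open>[0, 1, 2 * q]\<close>, which is not listed.\<close>

lemma block_vert:
  assumes "c < q" shows "vert c \<notin> Fam l"
proof
  assume "vert c \<in> Fam l"
  then obtain b where b: "b \<in> set (bl l)" "set b = vert c" by (auto simp: Fam_eq)
  have k: "2 * c \<in> set b" "2 * c < 2 * q" using b(2) assms by (auto simp: vert_def)
  have "trm (q - 2 * c div 2) ` set b = {0, 1, 2 * q}"
    using trm_vert'[OF assms] b(2) by (simp add: vert_def)
  then have "anchor (l, b, 2 * c) = [0, 1, 2 * q]"
    using anchor_iff[OF b(1) k, of 1 "2 * q" 0] q_ge_2 by simp
  moreover have "(l, b, 2 * c) \<in> set (marked bl)" using b(1) k by (simp add: mem_marked)
  ultimately have "[0, 1, 2 * q] \<in> set (map anchor (marked bl))" by (metis imageI set_map)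
  then have "[0, 1, 2 * q] \<in> set all_anchored"
    using check by (metis check_def set_msort)
  then show False by (simp add: mem_all_anchored)
qed

text \<open>Mark a finite point k of B and rotate it to residue 0. The resulting anchored triple
  comes from one marked block only. Conversely, any block b' that rotates to B has a point h going
  to k, and b' marked at h has the same anchored triple, so label, block and mark agree and the
  rotation follows.\<close>

lemma block_triple:
  assumes B: "B \<subseteq> {..2 * q}" "card B = 3" and no_vert: "\<And>c. c < q \<Longrightarrow> B \<noteq> vert c"
  shows "\<exists>!t. fst t < q \<and> B \<in> (`) (trm (fst t)) ` Fam (snd t)"
proof -
  have "\<not> B \<subseteq> {2 * q}" using B(2) card_mono[of "{2 * q}" B] by auto
  then obtain k where k: "k \<in> B" "k < 2 * q" using B(1) by (metis atMost_iff insertI1 le_neq_implies_less subset_iff)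
  define c where "c = k div 2"
  define a where "a = k mod 2"
  have c: "c < q" using k(2) by (auto simp: c_def)
  define B' where "B' = trm (q - c) ` B"
  have B'_sub: "B' \<subseteq> {..2 * q}" unfolding B'_def using image_trm_sub[OF B(1)] .
  have card_B': "card B' = 3"
    unfolding B'_def using B(2) card_image[OF inj_on_subset[OF trm_inj B(1)]] by simp
  have return: "trm c ` B' = B"
    unfolding B'_def image_trm_trm[OF B(1)] using c by (intro image_trm_multiple[OF B(1)]) simp
  have a: "a \<in> B'" unfolding B'_def a_def using trm_anchor[OF k(2)] k(1) by (metis c_def imageI)
  have "card (B' - {a}) = 2" using card_B' a by (simp add: card_Diff_subset)
  then obtain y' z' where "B' - {a} = {y', z'}" "y' \<noteq> z'" by (auto simp: card_2_iff)
  then obtain y z where yz: "B' - {a} = {y, z}" "y < z" by (metis insert_commute linorder_neqE_nat)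
  have B'_eq: "B' = {a, y, z}" and neq: "a \<noteq> y" "a \<noteq> z" using yz a by auto
  have "\<not> (y + a = 1 \<and> z = 2 * q)"
  proof
    assume "y + a = 1 \<and> z = 2 * q"
    then have "B' = vert 0" unfolding B'_eq vert_def by auto
    then show False using return trm_vert[OF c] no_vert[OF c] by simp
  qed
  then have mem: "[a, y, z] \<in> set all_anchored"
    using yz neq B'_sub B'_eq by (auto simp: mem_all_anchored a_def)
  have "successively (<) all_anchored" using check by (simp add: check_def)
  from ex1_sorted_listing[OF listing_anchored this mem]
  obtain m where m: "m \<in> set (marked bl) \<and> [a, y, z] \<in> set [anchor m]"
    and m_uniq: "\<forall>m'. m' \<in> set (marked bl) \<and> [a, y, z] \<in> set [anchor m'] \<longrightarrow> m' = m"
    by (rule ex1E)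
  obtain l b k' where lbk: "m = (l, b, k')" by (cases m)
  have b: "b \<in> set (bl l)" "k' \<in> set b" "k' < 2 * q" using m lbk mem_marked by auto
  define c' where "c' = k' div 2"
  have B'_b: "trm (q - c') ` set b = B'"
    using anchor_iff[OF b yz(2) neq] m lbk unfolding B'_eq c'_def by auto
  \<comment> \<open>The base block is rotated until its mark has residue 0, then until the mark has
    the residue c of k.\<close>
  have "B = trm c ` trm (q - c') ` set b" unfolding B'_b return ..
  also have "\<dots> = trm (q - c' + c) ` set b" by (rule image_trm_trm[OF block_sub[OF b(1)]])
  also have "\<dots> = trm ((q - c' + c) mod q) ` set b"
    by (rule image_trm_cong[OF block_sub[OF b(1)]]) simp
  finally have wit: "B = trm ((q - c' + c) mod q) ` set b" .
  show ?thesis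
  proof (rule ex1I[of _ "((q - c' + c) mod q, l)"])
    show "fst ((q - c' + c) mod q, l) < q \<and>
        B \<in> (`) (trm (fst ((q - c' + c) mod q, l))) ` Fam (snd ((q - c' + c) mod q, l))"
      using wit b(1) q_ge_2 by (auto simp: Fam_eq)
  next
    fix t assume t: "fst t < q \<and> B \<in> (`) (trm (fst t)) ` Fam (snd t)"
    obtain s l' where sl: "t = (s, l')" by fastforce
    then obtain b' where b': "b' \<in> set (bl l')" "B = trm s ` set b'" "s < q"
      using t by (auto simp: Fam_eq)
    then obtain h where h: "h \<in> set b'" "k = trm s h" using k(1) by blast
    have "h \<noteq> 2 * q" using h(2) k(2) by (auto simp: trm_def)
    then have h2: "h < 2 * q" using block_sub[OF b'(1)] h(1) by auto
    have ch: "c = (h div 2 + s) mod q" "a = h mod 2"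
      using h(2) trm_parity[OF h2] by (simp_all add: c_def a_def)
    have hq: "h div 2 < q" using h2 by auto
    \<comment> \<open>Both equations say that rotation by s takes the residue of h to c, written
      with truncated subtraction.\<close>
    have shift: "(s + (q - c)) mod q = (q - h div 2) mod q" "s = (q - h div 2 + c) mod q"
    proof -
      consider "h div 2 + s < q" "c = h div 2 + s" | "h div 2 + s \<ge> q" "c = h div 2 + s - q"
      proof (cases "h div 2 + s < q")
        case True
        then show thesis using ch(1) that(1) by simp
      next
        case False
        moreover from this have "h div 2 + s - q < q" using hq b'(3) by linarith
        ultimately show thesis using ch(1) that(2) by (simp add: le_mod_geq)
      qed
      then show "(s + (q - c)) mod q = (q - h div 2) mod q" "s = (q - h div 2 + c) mod q"
        using hq b'(3) by (cases; simp add: mod_if)+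
    qed
    have "trm (q - h div 2) ` set b' = trm (s + (q - c)) ` set b'"
      by (rule image_trm_cong[OF block_sub[OF b'(1)] shift(1)[symmetric]])
    also have "\<dots> = B'" unfolding B'_def b'(2) image_trm_trm[OF block_sub[OF b'(1)]] ..
    finally have "anchor (l', b', h) = [a, y, z]"
      using anchor_iff[OF b'(1) h(1) h2 yz(2) neq] ch(2) B'_eq by simp
    moreover have "(l', b', h) \<in> set (marked bl)" using b'(1) h(1) h2 by (simp add: mem_marked)
    ultimately have "(l', b', h) = m" using m_uniq by simp
    then show "t = ((q - c' + c) mod q, l)" using sl lbk shift(2) by (simp add: c'_def)
  qed
qed

sublocale proper_base_design q Fam
proof
  show "b \<subseteq> {..2 * q}" "card b = 3" if "b \<in> Fam l" for b l
    using that block_sub block_card by (auto simp: Fam_eq)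
  show "\<exists>!b. b \<in> Fam None \<union> Fam (Some j) \<and> x \<in> b \<and> y \<in> b"
    if xy: "x \<le> 2 * q" "y \<le> 2 * q" "x \<noteq> y" "\<not> (x \<in> core \<and> y \<in> core)" for x y j
  proof (cases "x < y")
    case True
    then show ?thesis using block_pair xy by blast
  next
    case False
    then have "\<exists>!b. b \<in> Fam None \<union> Fam (Some j) \<and> y \<in> b \<and> x \<in> b"
      using block_pair[of y x j] xy by linarith
    then show ?thesis by (simp only: conj_commute)
  qed
qed (fact block_core block_avoid block_parallel block_vert block_triple)+

end

section \<open>Conclusion\<close>

text \<open>F_q^n as the sequences supported below n: with pointwise operations a single ring
  contains these spaces for all n.\<close>

definition vec :: "nat \<Rightarrow> (nat \<Rightarrow> 'f :: {comm_ring_1, finite}) set" where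
  "vec n = {f. \<forall>i\<ge>n. f i = 0}"

lemma vec_eq: "(vec n :: (nat \<Rightarrow> 'f :: {comm_ring_1, finite}) set) = (\<lambda>g i. if i < n then g i else 0) ` ({..<n} \<rightarrow>\<^sub>E UNIV)"
proof
  show "(vec n :: (nat \<Rightarrow> 'f) set) \<subseteq> (\<lambda>g i. if i < n then g i else 0) ` ({..<n} \<rightarrow>\<^sub>E UNIV)"
  proof
    fix f :: "nat \<Rightarrow> 'f" assume "f \<in> vec n"
    then have "f = (\<lambda>i. if i < n then restrict f {..<n} i else 0)"
      by (auto simp: vec_def fun_eq_iff)
    then show "f \<in> (\<lambda>g i. if i < n then g i else 0) ` ({..<n} \<rightarrow>\<^sub>E UNIV)"
      by (rule image_eqI[of _ _ "restrict f {..<n}"]) simp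
  qed
next
  show "(\<lambda>g i. if i < n then g i else 0) ` ({..<n} \<rightarrow>\<^sub>E (UNIV :: 'f set)) \<subseteq> vec n"
    by (rule image_subsetI) (simp add: vec_def)
qed

lemma card_vec: "card (vec n :: (nat \<Rightarrow> 'f :: {comm_ring_1, finite}) set) = CARD('f) ^ n"
proof -
  have "inj_on (\<lambda>g i. if i < n then g i else 0) ({..<n} \<rightarrow>\<^sub>E (UNIV :: 'f set))"
  proof (rule inj_onI)
    fix g h :: "nat \<Rightarrow> 'f"
    assume gh: "g \<in> {..<n} \<rightarrow>\<^sub>E UNIV" "h \<in> {..<n} \<rightarrow>\<^sub>E UNIV"
      and eq: "(\<lambda>i. if i < n then g i else 0) = (\<lambda>i. if i < n then h i else 0)"
    show "g = h"
      by (rule PiE_ext[OF gh]) (use fun_cong[OF eq] in \<open>metis lessThan_iff\<close>)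
  qed
  then show ?thesis by (simp add: vec_eq card_image card_PiE)
qed

lemma finite_vec: "finite (vec n)"
  unfolding vec_eq by (intro finite_imageI finite_PiE) auto

lemma fin_subgroup_vec: "fin_subgroup (vec n :: (nat \<Rightarrow> 'f :: {comm_ring_1, finite}) set)"
proof
  show "finite (vec n :: (nat \<Rightarrow> 'f) set)" by (rule finite_vec)
  show "0 \<in> (vec n :: (nat \<Rightarrow> 'f) set)" by (simp add: vec_def)
  show "x - y \<in> vec n" if "x \<in> vec n" "y \<in> vec n" for x y :: "nat \<Rightarrow> 'f"
    using that by (simp add: vec_def)
qed

lemma of_nat_fun_eq_0: "(of_nat k :: 'a \<Rightarrow> 'f :: comm_ring_1) = 0 \<longleftrightarrow> of_nat k = (0 :: 'f)"
proof -
  have "(of_nat k :: 'a \<Rightarrow> 'f) x = of_nat k" for x by (induction k) auto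
  then show ?thesis by (simp add: fun_eq_iff)
qed

text \<open>The type variable \<open>'f\<close> carries the field with q elements, so that the
  numeral types 7 and 13 can be substituted for it.\<close>

lemma ex_GLS_base:
  fixes bl :: "bool option \<Rightarrow> nat list list"
  assumes q: "prime q" "q \<noteq> 3" and n: "n \<ge> 1" and check: "base_design.check q bl"
    and F: "CARD('f :: {comm_ring_1, finite}) = q" "of_nat q = (0 :: 'f)"
    and v: "v = 2 * q ^ n + 1"
  shows "(\<exists>(S :: nat set) p q (R :: nat set) \<B> D. GLS 1 {3, 6} {6} (2 * v) S p q R \<B> D) \<and>
         (\<exists>(S :: nat set) p q (R :: nat set) \<B> D. GLS_star 2 {3, 6} {6} (2 * v) S p q R \<B> D)"
proof -
  let ?G = "vec n :: (nat \<Rightarrow> 'f) set"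
  have "(of_nat q :: nat \<Rightarrow> 'f) = 0" using F(2) by (simp only: of_nat_fun_eq_0)
  then have vspace: "vspace ?G q" by (intro vspace.intro fin_subgroup_vec vspace_axioms.intro q(1))
  then interpret vspace ?G q .
  obtain U where U: "U \<subseteq> ?G - {0} \<and> (\<forall>x\<in>?G - {0}. \<exists>!u. u \<in> U \<and> x \<in> line u)"
    using ex_line_representatives by (rule exE)
  from check prime_ge_2_nat[OF q(1)] refl
  interpret checked_base q "\<lambda>l. set ` set (bl l)" bl by (rule checked_base.intro)
  have card_G: "card ?G = q ^ n" using card_vec[of n, where 'f = 'f] F by simp
  have "q ^ n > 1" using n prime_gt_1_nat[OF q(1)] by (intro one_less_power) auto
  then have "?G \<noteq> {0}" using card_G by auto
  interpret lifting ?G q "\<lambda>l. set ` set (bl l)" U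
  proof
    show "U \<subseteq> ?G - {0}" "q \<noteq> 3" "?G \<noteq> {0}" using U q(2) \<open>?G \<noteq> {0}\<close> by simp_all
    show "\<exists>!u. u \<in> U \<and> x \<in> line u" if "x \<in> ?G - {0}" for x by (rule bspec[OF conjunct2[OF U] that])
  qed
  have "card X = v" using card_X card_G v by (simp add: card_cartesian_product)
  then show ?thesis using ex_GLS by simp
qed

theorem theorem3p3:
  fixes n v :: nat
  assumes "n \<ge> 1" and "v \<in> {3 ^ n, 2 * 7 ^ n + 1, 2 * 13 ^ n + 1}"
  shows "(\<exists>(S :: nat set) p q (R :: nat set) \<B> D. GLS 1 {3, 6} {6} (2 * v) S p q R \<B> D) \<and>
         (\<exists>(S :: nat set) p q (R :: nat set) \<B> D. GLS_star 2 {3, 6} {6} (2 * v) S p q R \<B> D)"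
proof -
  consider "v = 3 ^ n" | "v = 2 * 7 ^ n + 1" | "v = 2 * 13 ^ n + 1" using assms(2) by auto
  then show ?thesis
  proof cases
    case 1
    let ?G = "vec n :: (nat \<Rightarrow> 3) set"
    interpret fin_subgroup ?G by (rule fin_subgroup_vec)
    have "(of_nat 3 :: 3) = 0" by simp
    then have "(of_nat 3 :: nat \<Rightarrow> 3) = 0" by (simp only: of_nat_fun_eq_0)
    then have char: "(3 :: nat \<Rightarrow> 3) = 0" by simp
    interpret large_set ?G "?G - {0}" "\<lambda>d. (\<lambda>x. {x, x + d, x - d}) ` ?G"
      "\<lambda>d. {B. B \<subseteq> ?G \<and> card B = 3 \<and> \<Sum>B = d}"
      using char by (rule large_set_char_3)
    have "card ?G = v" using card_vec[of n, where 'f = 3] 1 by simp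
    then show ?thesis using ex_GLS by simp
  next
    case 2
    then show ?thesis
      by (intro ex_GLS_base[where 'f = 7, OF _ _ assms(1) check7]) simp_all
  next
    case 3
    then show ?thesis
      by (intro ex_GLS_base[where 'f = 13, OF _ _ assms(1) check13]) simp_all
  qed
qed

end
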